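(* Let $\Omega\subset\mathbb{R}^n$ be a bounded domain with Lipschitz continuous boundary, let $\eta>0$ be a constant, and let $u_0\in D(\partial\mathrm{TV})$ and $v_0\in D(\partial \mathrm{TV})\cap L^2(\Omega)$. Let $u$ be the weak solution of the damped second-order total variation flow $$\begin{cases}\ddot u(t)+\eta\dot u(t)-\operatorname{div}\left(\frac{\nabla u(t)}{|\nabla u(t)|}\right)=0 & \text{in }\Omega\times(0,\infty),\\ u(0)=u_0,\quad \dot u(0)=v_0 & \text{in }\Omega,\\ \partial_\nu u(t)=0 & \text{on }\partial\Omega\times(0,\infty),\end{cases}$$ and let $\mathcal{E}(t):=\frac12\|\dot u(t)\|_{L^2(\Omega)}^2+\mathrm{TV}(u(t))$. If the initial condition is nontrivial, i.e. $\mathcal{E}(0)>0$, then there exists no finite extinction time for $u$, i.e. there is no $T\in(0,\infty)$ such that $\mathcal{E}(t)=0$ for all $t\ge T$.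
   Context: For $u\in L^1(\Omega)$ put $\|Du\|:=\sup\{\int_\Omega u\operatorname{div}\mathbf v\,dx:\ \mathbf v\in C_0^\infty(\Omega;\mathbb{R}^n),\ |\mathbf v(x)|\le 1\ \forall x\in\Omega\}$, and $BV(\Omega):=\{u\in L^1(\Omega):\|u\|_{L^1}+\|Du\|<\infty\}$. The total variation functional $\mathrm{TV}:L^2(\Omega)\to[0,\infty]$ is $\mathrm{TV}(u)=\|Du\|$ if $u\in L^2(\Omega)\cap BV(\Omega)$ and $\mathrm{TV}(u)=\infty$ if $u\in L^2(\Omega)\setminus BV(\Omega)$. $\partial\mathrm{TV}$ is its subdifferential in the Hilbert space $L^2(\Omega)$, and $D(\partial\mathrm{TV})=\{u\in L^2(\Omega):\partial\mathrm{TV}(u)\neq\emptyset\}$. The expression $-\operatorname{div}(\nabla u/|\nabla u|)$ formally denotes an element of $\partial\mathrm{TV}(u)$. Dots denote time derivatives, with values in $L^2(\Omega)$. A weak solution is a function $u\in L^\infty([0,\infty);D(\partial\mathrm{TV}))\cap W_2^\infty([0,\infty);L^2(\Omega))$ with $u(0)=u_0$, $\dot u(0)=v_0$ and $\ddot u(t)+\eta\dot u(t)+\partial\mathrm{TV}(u(t))\ni 0$ for almost every $t\ge0$. Here $W_2^\infty([0,\infty);L^2(\Omega))$ is the space of $u$ with $u,\dot u,\ddot u\in L^\infty([0,\infty);L^2(\Omega))$, and $L^\infty([0,\infty);D(\partial\mathrm{TV}))$ is the set of $u\in L^\infty([0,\infty);L^2(\Omega))$ with $u(t)\in D(\partial\mathrm{TV})$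 for almost every $t$. The Neumann condition ($\nu$ the outward unit normal on $\partial\Omega$) is understood in the weak sense encoded in the subdifferential $\partial\mathrm{TV}$ on $L^2(\Omega)$. *)

theory Defs
  imports "HOL-Analysis.Analysis"
begin

section \<open>The space of square integrable functions as a type\<close>

text \<open>
  The type \<open>'a l2\<close> consists of the Lebesgue almost-everywhere classes of square integrable real
  functions on the whole Euclidean space \<open>'a\<close>. The Hilbert space of a subset \<open>\<Omega>\<close> appears below as the
  subspace \<open>L2 \<Omega>\<close> of classes vanishing outside \<open>\<Omega>\<close>, that is, functions on \<open>\<Omega>\<close> are identified with
  their extension by zero. The instances of \<^class>\<open>banach\<close> and \<^class>\<open>second_countable_topology\<close> make the Bochner integral of the
  library available for curves with values in \<open>'a l2\<close>.
\<close>

definition square_integrable :: "('a::euclidean_space \<Rightarrow> real) \<Rightarrow> bool" where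
  "square_integrable f \<longleftrightarrow> f \<in> borel_measurable lebesgue \<and> integrable lebesgue (\<lambda>x. (f x)\<^sup>2)"

definition l2_rel :: "('a::euclidean_space \<Rightarrow> real) \<Rightarrow> ('a \<Rightarrow> real) \<Rightarrow> bool" where
  "l2_rel f g \<longleftrightarrow> square_integrable f \<and> square_integrable g \<and> (AE x in lebesgue. f x = g x)"

lemma square_integrable_mult:
  assumes "square_integrable f" "square_integrable g"
  shows "integrable lebesgue (\<lambda>x. f x * g x)"
proof (rule Bochner_Integration.integrable_bound)
  show "integrable lebesgue (\<lambda>x. (f x)\<^sup>2 + (g x)\<^sup>2)"
    using assms by (auto simp: square_integrable_def)
  show "(\<lambda>x. f x * g x) \<in> borel_measurable lebesgue"
    using assms by (auto simp: square_integrable_def)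
  have "\<bar>a * b\<bar> \<le> a\<^sup>2 + b\<^sup>2" for a b :: real
  proof -
    have "0 \<le> (\<bar>a\<bar> - \<bar>b\<bar>)\<^sup>2" "0 \<le> \<bar>a\<bar> * \<bar>b\<bar>" by auto
    then show ?thesis unfolding power2_diff abs_mult power2_abs by linarith
  qed
  then show "AE x in lebesgue. norm (f x * g x) \<le> norm ((f x)\<^sup>2 + (g x)\<^sup>2)"
    by auto
qed

lemma square_integrable_add:
  assumes "square_integrable f" "square_integrable g"
  shows "square_integrable (\<lambda>x. f x + g x)"
  using assms square_integrable_mult[OF assms]
  by (auto simp: square_integrable_def power2_sum mult.assoc)

lemma square_integrable_scale: "square_integrable f \<Longrightarrow> square_integrable (\<lambda>x. c * f x)"
  by (auto simp: square_integrable_def power_mult_distrib)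

lemma square_integrable_zero: "square_integrable (\<lambda>x. 0)"
  by (auto simp: square_integrable_def)

quotient_type (overloaded) 'a l2 = "'a::euclidean_space \<Rightarrow> real" / partial: l2_rel
proof (rule part_equivpI)
  show "\<exists>f. l2_rel f (f :: 'a \<Rightarrow> real)"
    using square_integrable_zero by (auto simp: l2_rel_def)
  show "symp (l2_rel :: ('a \<Rightarrow> real) \<Rightarrow> _)"
    by (rule sympI) (simp add: l2_rel_def eq_commute)
  show "transp (l2_rel :: ('a \<Rightarrow> real) \<Rightarrow> _)"
  proof (rule transpI)
    fix f g h :: "'a \<Rightarrow> real"
    assume fg: "l2_rel f g" and gh: "l2_rel g h"
    have "AE x in lebesgue. f x = h x"
      using fg gh unfolding l2_rel_def by (auto elim: eventually_elim2)
    with fg gh show "l2_rel f h" by (simp add: l2_rel_def)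
  qed
qed

instantiation l2 :: (euclidean_space) real_inner
begin

lift_definition zero_l2 :: "'a l2" is "\<lambda>x. 0"
  using square_integrable_zero by (auto simp: l2_rel_def)

lift_definition plus_l2 :: "'a l2 \<Rightarrow> 'a l2 \<Rightarrow> 'a l2" is "\<lambda>f g x. f x + g x"
  unfolding l2_rel_def by (auto intro: square_integrable_add)

lift_definition scaleR_l2 :: "real \<Rightarrow> 'a l2 \<Rightarrow> 'a l2" is "\<lambda>c f x. c * f x"
  unfolding l2_rel_def by (auto intro: square_integrable_scale)

definition uminus_l2 :: "'a l2 \<Rightarrow> 'a l2" where "uminus_l2 u = (- 1) *\<^sub>R u"
definition minus_l2 :: "'a l2 \<Rightarrow> 'a l2 \<Rightarrow> 'a l2" where "minus_l2 u v = u + - v"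

lift_definition inner_l2 :: "'a l2 \<Rightarrow> 'a l2 \<Rightarrow> real" is "\<lambda>f g. integral\<^sup>L lebesgue (\<lambda>x. f x * g x)"
  unfolding l2_rel_def square_integrable_def by (intro integral_cong_AE) auto

definition norm_l2 :: "'a l2 \<Rightarrow> real" where "norm_l2 u = sqrt (u \<bullet> u)"
definition dist_l2 :: "'a l2 \<Rightarrow> 'a l2 \<Rightarrow> real" where "dist_l2 u v = norm (u - v)"
definition sgn_l2 :: "'a l2 \<Rightarrow> 'a l2" where "sgn_l2 u = inverse (norm u) *\<^sub>R u"
definition uniformity_l2 :: "('a l2 \<times> 'a l2) filter" where
  "uniformity_l2 = (INF e\<in>{0<..}. principal {(u, v). dist u v < e})"
definition open_l2 :: "'a l2 set \<Rightarrow> bool" where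
  "open_l2 U = (\<forall>u\<in>U. eventually (\<lambda>(u', v). u' = u \<longrightarrow> v \<in> U) uniformity)"

instance
proof
  fix u v w :: "'a l2" and a b :: real
  show "u + v + w = u + (v + w)" 
    by transfer (auto simp: l2_rel_def add.assoc intro!: square_integrable_add)
  show com: "u + v = v + u" 
    by transfer (auto simp: l2_rel_def add.commute intro!: square_integrable_add)
  show "0 + u = u" by transfer (auto simp: l2_rel_def)
  show "- u + u = 0" unfolding uminus_l2_def
    by transfer (auto simp: l2_rel_def square_integrable_zero)
  show "u - v = u + - v" by (rule minus_l2_def)
  show "a *\<^sub>R (u + v) = a *\<^sub>R u + a *\<^sub>R v"
    by transfer (simp add: l2_rel_def distrib_left distrib_right square_integrable_add square_integrable_scale)
  show "(a + b) *\<^sub>R u = a *\<^sub>R u + b *\<^sub>R u"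
    by transfer (simp add: l2_rel_def distrib_left distrib_right square_integrable_add square_integrable_scale)
  show "a *\<^sub>R b *\<^sub>R u = (a * b) *\<^sub>R u"
    by transfer (simp add: l2_rel_def mult.assoc square_integrable_scale)
  show "1 *\<^sub>R u = u" by transfer (auto simp: l2_rel_def)
  show "dist u v = norm (u - v)" by (rule dist_l2_def)
  show "sgn u = inverse (norm u) *\<^sub>R u" by (rule sgn_l2_def)
  show "uniformity = (INF e\<in>{0<..}. principal {(u, v :: 'a l2). dist u v < e})"
    by (rule uniformity_l2_def)
  show "open U \<longleftrightarrow> (\<forall>u\<in>U. \<forall>\<^sub>F (u', v) in uniformity. u' = u \<longrightarrow> v \<in> U)" for U :: "'a l2 set"
    by (rule open_l2_def)
  show "u \<bullet> v = v \<bullet> u" by transfer (simp add: mult.commute)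
  show "(u + v) \<bullet> w = u \<bullet> w + v \<bullet> w"
    by transfer (auto simp: l2_rel_def distrib_right square_integrable_mult)
  show "(a *\<^sub>R u) \<bullet> v = a * (u \<bullet> v)"
    by transfer (simp add: mult.assoc)
  show "0 \<le> u \<bullet> u" by transfer simp
  show "u \<bullet> u = 0 \<longleftrightarrow> u = 0"
    by transfer (auto simp: l2_rel_def square_integrable_zero integral_nonneg_eq_0_iff_AE square_integrable_mult)
  show "norm u = sqrt (u \<bullet> u)" by (rule norm_l2_def)
qed

end

lemma square_integrable_rep_l2: "square_integrable (rep_l2 u)"
  using Quotient_rep_reflp[OF Quotient_l2] by (auto simp: l2_rel_def)

lemma rep_abs_l2: "square_integrable f \<Longrightarrow> AE x in lebesgue. rep_l2 (abs_l2 f) x = f x"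
  using Quotient_rep_abs[OF Quotient_l2, of f] by (auto simp: l2_rel_def)

lemma abs_rep_l2 [simp]: "abs_l2 (rep_l2 u) = u"
  by (rule Quotient_abs_rep[OF Quotient_l2])

lemma l2_eqI: "AE x in lebesgue. rep_l2 u x = rep_l2 v x \<Longrightarrow> u = v"
  using Quotient_rel_rep[OF Quotient_l2, of u v] by (auto simp: l2_rel_def square_integrable_rep_l2)

lemma abs_l2_cases: obtains f where "square_integrable f" "u = abs_l2 f"
  by (metis abs_rep_l2 square_integrable_rep_l2)

lemma l2_rel_refl: "square_integrable f \<Longrightarrow> l2_rel f f" by (simp add: l2_rel_def)

lemma abs_l2_add: "square_integrable f \<Longrightarrow> square_integrable g \<Longrightarrow> abs_l2 f + abs_l2 g = abs_l2 (\<lambda>x. f x + g x)"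
  by (simp add: plus_l2.abs_eq l2_rel_refl)
lemma abs_l2_scale: "square_integrable f \<Longrightarrow> c *\<^sub>R abs_l2 f = abs_l2 (\<lambda>x. c * f x)"
  by (simp add: scaleR_l2.abs_eq l2_rel_refl)
lemma abs_l2_diff:
  assumes "square_integrable f" "square_integrable g"
  shows "abs_l2 f - abs_l2 g = abs_l2 (\<lambda>x. f x - g x)"
  using abs_l2_add[OF assms(1) square_integrable_scale[OF assms(2), of "-1"]]
  by (simp only: minus_l2_def uminus_l2_def abs_l2_scale[OF assms(2)]) simp
lemma square_integrable_diff:
  assumes "square_integrable f" "square_integrable g"
  shows "square_integrable (\<lambda>x. f x - g x)"
  using square_integrable_add[OF assms(1) square_integrable_scale[OF assms(2), of "-1"]] by simp
lemma inner_abs_l2: "square_integrable f \<Longrightarrow> square_integrable g \<Longrightarrow>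
    abs_l2 f \<bullet> abs_l2 g = integral\<^sup>L lebesgue (\<lambda>x. f x * g x)"
  by (simp add: inner_l2.abs_eq l2_rel_refl)
lemma norm_abs_l2: "square_integrable f \<Longrightarrow> norm (abs_l2 f) = sqrt (integral\<^sup>L lebesgue (\<lambda>x. (f x)\<^sup>2))"
  by (simp add: norm_l2_def inner_abs_l2 power2_eq_square)
lemma abs_l2_sum:
  assumes "finite I" "\<And>i. i \<in> I \<Longrightarrow> square_integrable (f i)"
  shows "square_integrable (\<lambda>x. \<Sum>i\<in>I. f i x) \<and> (\<Sum>i\<in>I. abs_l2 (f i)) = abs_l2 (\<lambda>x. \<Sum>i\<in>I. f i x)"
  using assms
proof (induction I)
  case empty then show ?case by (simp add: square_integrable_zero zero_l2_def)
next
  case (insert i I)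
  then show ?case by (auto intro: square_integrable_add simp: abs_l2_add)
qed

lemma norm_abs_l2_nn:
  assumes "square_integrable f"
  shows "ennreal ((norm (abs_l2 f))\<^sup>2) = (\<integral>\<^sup>+x. ennreal ((f x)\<^sup>2) \<partial>lebesgue)"
  using assms by (simp add: norm_abs_l2 square_integrable_def nn_integral_eq_integral)

lemma square_integrableI:
  assumes "f \<in> borel_measurable lebesgue" "(\<integral>\<^sup>+x. ennreal ((f x)\<^sup>2) \<partial>lebesgue) < \<infinity>"
  shows "square_integrable f"
  unfolding square_integrable_def
proof
  show "integrable lebesgue (\<lambda>x. (f x)\<^sup>2)"
  proof (rule integrableI_bounded)
    show "(\<lambda>x. (f x)\<^sup>2) \<in> borel_measurable lebesgue"
      using assms(1) by (rule borel_measurable_power)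
  qed (use assms(2) in simp)
qed fact

lemma square_integrable_mono:
  assumes "f \<in> borel_measurable lebesgue" "square_integrable g" "\<And>x. \<bar>f x\<bar> \<le> \<bar>g x\<bar>"
  shows "square_integrable f"
  unfolding square_integrable_def
proof
  show "integrable lebesgue (\<lambda>x. (f x)\<^sup>2)"
  proof (rule Bochner_Integration.integrable_bound)
    show "integrable lebesgue (\<lambda>x. (g x)\<^sup>2)" using assms(2) by (simp add: square_integrable_def)
    show "(\<lambda>x. (f x)\<^sup>2) \<in> borel_measurable lebesgue"
      using assms(1) by (rule borel_measurable_power)
    have "(f x)\<^sup>2 \<le> (g x)\<^sup>2" for x
      using assms(3)[of x] by (rule abs_le_square_iff[THEN iffD1])
    then show "AE x in lebesgue. norm ((f x)\<^sup>2) \<le> norm ((g x)\<^sup>2)" by simp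
  qed
qed fact

lemma norm_abs_l2_le:
  assumes "square_integrable f" "(\<integral>\<^sup>+x. ennreal ((f x)\<^sup>2) \<partial>lebesgue) \<le> ennreal (c\<^sup>2)" "0 \<le> c"
  shows "norm (abs_l2 f) \<le> c"
proof (rule power2_le_imp_le)
  show "(norm (abs_l2 f))\<^sup>2 \<le> c\<^sup>2"
    using assms(2) unfolding norm_abs_l2_nn[OF assms(1), symmetric] by (simp add: ennreal_le_iff)
qed fact

instance l2 :: (euclidean_space) complete_space
proof
  fix X :: "nat \<Rightarrow> 'a l2"
  assume X: "Cauchy X"
  have "\<exists>r. strict_mono r \<and> (\<forall>k. dist (X (r (Suc k))) (X (r k)) < (1/2)^k)"
  proof -
    have ex: "\<exists>N. \<forall>m\<ge>N. \<forall>n\<ge>N. dist (X m) (X n) < (1/2)^k" for k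
      using X by (auto simp: Cauchy_def)
    then obtain N where N: "\<And>k m n. m \<ge> N k \<Longrightarrow> n \<ge> N k \<Longrightarrow> dist (X m) (X n) < (1/2)^k"
      using choice[of "\<lambda>k N. \<forall>m\<ge>N. \<forall>n\<ge>N. dist (X m) (X n) < (1/2)^k"] by blast
    define r where "r = (\<lambda>k. (\<Sum>i\<le>k. N i) + k)"
    have "N k \<le> r k" for k
      unfolding r_def using member_le_sum[of k "{..k}" N] by simp
    moreover have "r k < r (Suc k)" for k by (simp add: r_def)
    ultimately have le: "N k \<le> r k" "N k \<le> r (Suc k)" and "strict_mono r" for k
      by (auto simp: strict_mono_Suc_iff) (meson less_imp_le order.trans)
    moreover have "dist (X (r (Suc k))) (X (r k)) < (1/2)^k" for k
      by (rule N[OF le(2) le(1)])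
    ultimately show ?thesis by blast
  qed
  then obtain r where r: "strict_mono r" and
    fast: "\<And>k. dist (X (r (Suc k))) (X (r k)) < (1/2)^k" by blast
  define f where "f = (\<lambda>k. rep_l2 (X (r k)))"
  have sq: "square_integrable (f k)" for k by (simp add: f_def square_integrable_rep_l2)
  have [measurable]: "f k \<in> borel_measurable lebesgue" for k
    using sq by (simp add: square_integrable_def)
  have Xf: "X (r k) = abs_l2 (f k)" for k by (simp add: f_def)
  define g where "g = (\<lambda>k x. \<bar>f (Suc k) x - f k x\<bar>)"
  have sqd: "square_integrable (\<lambda>x. f i x - f j x)" for i j
    by (intro square_integrable_diff sq)
  have [measurable]: "g k \<in> borel_measurable lebesgue" for k
    unfolding g_def by measurable
  have sqg: "square_integrable (g k)" for k
    by (rule square_integrable_mono[OF _ sqd[of "Suc k" k]]) (auto simp: g_def)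
  have ng: "norm (abs_l2 (g k)) \<le> (1/2)^k" for k
  proof -
    have "norm (abs_l2 (g k)) = norm (X (r (Suc k)) - X (r k))"
      by (simp add: Xf abs_l2_diff sq norm_abs_l2 sqg sqd) (simp add: g_def)
    then show ?thesis using fast[of k] by (simp add: dist_norm)
  qed
  define S where "S = (\<lambda>n x. \<Sum>k<n. g k x)"
  have [measurable]: "S n \<in> borel_measurable lebesgue" for n
    unfolding S_def by measurable
  have sqS: "square_integrable (S n)" and absS: "abs_l2 (S n) = (\<Sum>k<n. abs_l2 (g k))" for n
    using abs_l2_sum[of "{..<n}" g] sqg by (auto simp: S_def)
  have nS: "norm (abs_l2 (S n)) \<le> 2" for n
  proof -
    have "norm (abs_l2 (S n)) \<le> (\<Sum>k<n. (1/2)^k)"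
      unfolding absS by (intro sum_norm_le ng)
    also have "\<dots> \<le> 2" using geometric_sum[of "1/2::real" n] by simp
    finally show ?thesis .
  qed
  have mono: "incseq (\<lambda>n x. ennreal ((S n x)\<^sup>2))"
  proof (rule incseq_SucI, rule le_funI)
    fix n x
    have "0 \<le> S n x" "0 \<le> g n x" "S (Suc n) x = S n x + g n x" by (auto simp: S_def g_def sum_nonneg)
    then show "ennreal ((S n x)\<^sup>2) \<le> ennreal ((S (Suc n) x)\<^sup>2)"
      by (intro ennreal_leI power_mono) auto
  qed
  have "(\<integral>\<^sup>+x. (SUP n. ennreal ((S n x)\<^sup>2)) \<partial>lebesgue) = (SUP n. \<integral>\<^sup>+x. ennreal ((S n x)\<^sup>2) \<partial>lebesgue)"
    by (intro nn_integral_monotone_convergence_SUP mono) measurable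
  also have "\<dots> \<le> ennreal (2\<^sup>2)"
  proof (rule SUP_least)
    fix n
    have "(norm (abs_l2 (S n)))\<^sup>2 \<le> 2\<^sup>2" using nS[of n] by (intro power_mono) auto
    then show "(\<integral>\<^sup>+x. ennreal ((S n x)\<^sup>2) \<partial>lebesgue) \<le> ennreal (2\<^sup>2)"
      unfolding norm_abs_l2_nn[OF sqS, symmetric] by (rule ennreal_leI)
  qed
  finally have fin: "(\<integral>\<^sup>+x. (SUP n. ennreal ((S n x)\<^sup>2)) \<partial>lebesgue) \<noteq> \<infinity>"
    by (auto simp: top_unique)
  have "AE x in lebesgue. (SUP n. ennreal ((S n x)\<^sup>2)) \<noteq> \<infinity>"
    by (rule nn_integral_PInf_AE[OF _ fin]) measurable
  then have conv: "AE x in lebesgue. convergent (\<lambda>k. f k x)"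
  proof eventually_elim
    case (elim x)
    then obtain C where C: "(SUP n. ennreal ((S n x)\<^sup>2)) = ennreal C" "0 \<le> C"
      by (cases "SUP n. ennreal ((S n x)\<^sup>2)" rule: ennreal_cases) auto
    have "(S n x)\<^sup>2 \<le> C" for n
      using SUP_upper[of n UNIV "\<lambda>n. ennreal ((S n x)\<^sup>2)"] C by simp
    then have "(\<Sum>k<n. g k x) \<le> sqrt C" for n
      unfolding S_def by (rule real_le_rsqrt)
    then have "summable (\<lambda>k. g k x)"
      using bounded_imp_summable[of "\<lambda>k. g k x" "sqrt C"]
      by (simp only: lessThan_Suc_atMost[symmetric]) (simp only: g_def abs_ge_zero)
    then have "summable (\<lambda>k. f (Suc k) x - f k x)"
      unfolding g_def by (rule summable_rabs_cancel)
    then have "convergent (\<lambda>n. \<Sum>k<n. f (Suc k) x - f k x)"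
      by (simp add: summable_iff_convergent)
    then have "convergent (\<lambda>n. f n x - f 0 x)"
      by (simp only: sum_lessThan_telescope[of "\<lambda>k. f k x"])
    from convergent_add[OF this convergent_const[of "f 0 x"]] show ?case by simp
  qed
  define F where "F = (\<lambda>x. lim (\<lambda>k. f k x))"
  have [measurable]: "F \<in> borel_measurable lebesgue"
    unfolding F_def by measurable
  have lim: "AE x in lebesgue. (\<lambda>k. f k x) \<longlonglongrightarrow> F x"
    using conv by eventually_elim (simp add: F_def convergent_LIMSEQ_iff)
  have Cau: "Cauchy (\<lambda>k. X (r k))"
    using Cauchy_subseq_Cauchy[OF X r] by (simp add: o_def)
  have bd: "(\<integral>\<^sup>+x. ennreal ((F x - f m x)\<^sup>2) \<partial>lebesgue) \<le> ennreal (e\<^sup>2)"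
    if M: "\<And>k. k \<ge> M \<Longrightarrow> dist (X (r k)) (X (r m)) < e" for M m e
  proof -
    have "(\<integral>\<^sup>+x. ennreal ((F x - f m x)\<^sup>2) \<partial>lebesgue)
        = (\<integral>\<^sup>+x. liminf (\<lambda>k. ennreal ((f k x - f m x)\<^sup>2)) \<partial>lebesgue)"
    proof (rule nn_integral_cong_AE, use lim in eventually_elim)
      case (elim x)
      then have "(\<lambda>k. ennreal ((f k x - f m x)\<^sup>2)) \<longlonglongrightarrow> ennreal ((F x - f m x)\<^sup>2)"
        by (intro tendsto_intros)
      then show ?case by (rule lim_imp_Liminf[OF sequentially_bot, symmetric])
    qed
    also have "\<dots> \<le> liminf (\<lambda>k. \<integral>\<^sup>+x. ennreal ((f k x - f m x)\<^sup>2) \<partial>lebesgue)"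
      by (intro nn_integral_liminf) measurable
    also have "\<dots> \<le> ennreal (e\<^sup>2)"
    proof (rule Liminf_le, simp, rule eventually_sequentiallyI[of M])
      fix k assume "k \<ge> M"
      from M[OF this] have "norm (abs_l2 (\<lambda>x. f k x - f m x)) < e"
        by (simp add: Xf dist_norm abs_l2_diff sq)
      then have "(norm (abs_l2 (\<lambda>x. f k x - f m x)))\<^sup>2 \<le> e\<^sup>2" by (intro power_mono) auto
      then show "(\<integral>\<^sup>+x. ennreal ((f k x - f m x)\<^sup>2) \<partial>lebesgue) \<le> ennreal (e\<^sup>2)"
        unfolding norm_abs_l2_nn[OF sqd, symmetric] by (rule ennreal_leI)
    qed
    finally show ?thesis .
  qed
  have sqF: "square_integrable F"
  proof -
    obtain M where M: "\<And>k m. k \<ge> M \<Longrightarrow> m \<ge> M \<Longrightarrow> dist (X (r k)) (X (r m)) < 1"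
      using Cau unfolding Cauchy_def by (meson zero_less_one)
    have "square_integrable (\<lambda>x. F x - f M x)"
      by (rule square_integrableI) (use bd[of M M 1] M[of _ M] in \<open>auto intro: le_less_trans\<close>)
    from square_integrable_add[OF this sq[of M]] show ?thesis by simp
  qed
  have "(\<lambda>k. X (r k)) \<longlonglongrightarrow> abs_l2 F"
  proof (rule metric_LIMSEQ_I)
    fix e :: real assume "0 < e"
    then obtain M where M: "\<And>k m. k \<ge> M \<Longrightarrow> m \<ge> M \<Longrightarrow> dist (X (r k)) (X (r m)) < e/2"
      using Cau unfolding Cauchy_def by (meson half_gt_zero)
    have "dist (X (r m)) (abs_l2 F) < e" if "m \<ge> M" for m
    proof -
      have "norm (abs_l2 (\<lambda>x. F x - f m x)) \<le> e/2"
        using bd[of M m "e/2"] M[OF _ that] \<open>0 < e\<close>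
        by (intro norm_abs_l2_le square_integrable_diff sqF sq) auto
      then show ?thesis
        using \<open>0 < e\<close> by (simp add: dist_norm Xf norm_minus_commute abs_l2_diff[OF sqF sq, symmetric])
    qed
    then show "\<exists>M. \<forall>m\<ge>M. dist (X (r m)) (abs_l2 F) < e" by blast
  qed
  then show "convergent X"
    using Cauchy_converges_subseq[OF X r] by (auto simp: o_def convergent_def)
qed

instance l2 :: (euclidean_space) banach ..

lemma square_integrable_indicator:
  "A \<in> lmeasurable \<Longrightarrow> square_integrable (indicator A :: 'a::euclidean_space \<Rightarrow> real)"
proof -
  assume A: "A \<in> lmeasurable"
  have "(\<lambda>x. (indicator A x :: real)\<^sup>2) = indicator A" by (auto simp: indicator_def)
  moreover have "integrable lebesgue (indicator A :: 'a \<Rightarrow> real)"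
    using A by (intro integrable_real_indicator) (simp_all add: fmeasurable_def del: emeasure_completion)
  ultimately show ?thesis by (auto simp: square_integrable_def)
qed

lemma dense_abs_l2_indicator:
  fixes B :: "'a::euclidean_space set set" and S :: "'a l2 set"
  assumes basis: "topological_basis B" "countable B"
    and S: "closed S"
    and fin: "\<And>F. finite F \<Longrightarrow> F \<subseteq> B \<Longrightarrow> \<Union>F \<in> lmeasurable \<Longrightarrow> abs_l2 (indicator (\<Union>F)) \<in> S"
    and A: "A \<in> lmeasurable"
  shows "abs_l2 (indicator A) \<in> S"
proof -
  have "\<exists>s\<in>S. dist s (abs_l2 (indicator A)) < e" if "e > 0" for e
  proof -
    define d where "d = e\<^sup>2 / 4"
    have "d > 0" using \<open>e > 0\<close> by (simp add: d_def)
    obtain U where U: "open U" "A \<subseteq> U" "U - A \<in> lmeasurable" "emeasure lebesgue (U - A) < ennreal d"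
      using sets_lebesgue_outer_open[of A d] A \<open>d > 0\<close> by (metis fmeasurableD)
    have UA: "U = A \<union> (U - A)" using U(2) by blast
    have Um: "U \<in> lmeasurable" by (subst UA) (intro fmeasurable.Un A U(3))
    obtain B' where B': "B' \<subseteq> B" "\<Union>B' = U"
      using basis(1) U(1) unfolding topological_basis_def by blast
    have "countable (insert {} B')" using B'(1) basis(2) countable_subset by blast
    define C where "C = from_nat_into (insert {} B')"
    have C: "range C = insert {} B'"
      unfolding C_def by (rule range_from_nat_into, simp, fact)
    define V where "V = (\<lambda>n. \<Union>(C ` {..n}))"
    have CU: "C n \<subseteq> U" and Cm: "C n \<in> sets lebesgue" for n
    proof -
      have "C n \<in> insert {} B'" using C by auto
      then show "C n \<subseteq> U" using B'(2) by auto
      from \<open>C n \<in> insert {} B'\<close> have "open (C n)"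
        using B'(1) topological_basis_open[OF basis(1)] by auto
      then show "C n \<in> sets lebesgue" by simp
    qed
    have VU: "V n \<subseteq> U" for n using CU by (auto simp: V_def)
    have Vs: "V n \<in> sets lebesgue" for n using Cm by (auto simp: V_def)
    have Vm: "V n \<in> lmeasurable" for n by (rule fmeasurableI2[OF Um VU Vs])
    have "(\<Union>n. V n) = U"
    proof -
      have "(\<Union>n. V n) = \<Union>(range C)" by (auto simp: V_def)
      then show ?thesis using C B'(2) by simp
    qed
    moreover have "incseq V" unfolding V_def incseq_def by (intro allI impI Union_mono image_mono) auto
    ultimately have lm: "(\<lambda>n. measure lebesgue (V n)) \<longlonglongrightarrow> measure lebesgue U"
      using Lim_measure_incseq[of V lebesgue] Vs fmeasurableD2[OF Um] by auto
    have "eventually (\<lambda>n. measure lebesgue U - d < measure lebesgue (V n)) sequentially"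
      using \<open>d > 0\<close> by (intro order_tendstoD(1)[OF lm]) simp
    then obtain n where "measure lebesgue U - d < measure lebesgue (V n)"
      using eventually_happens'[OF sequentially_bot] by blast
    then have n: "measure lebesgue U - measure lebesgue (V n) < d" by simp
    have mUV: "measure lebesgue (U - V n) < d"
      using n measurable_measure_Diff[OF Um Vs VU] by simp
    have mUA: "measure lebesgue (U - A) < d"
      using U(3,4) \<open>d > 0\<close> by (simp add: emeasure_eq_measure2 ennreal_less_iff)
    have ind: "(indicator (V n) x - indicator A x :: real)\<^sup>2 \<le> indicator (U - V n) x + indicator (U - A) x" for x
      using VU[of n] U(2) by (auto simp: indicator_def)
    have sqV: "square_integrable (indicator (V n) :: 'a \<Rightarrow> real)" and sqA: "square_integrable (indicator A :: 'a \<Rightarrow> real)"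
      using Vm A by (auto intro: square_integrable_indicator)
    have UV: "U - V n \<in> lmeasurable" by (rule fmeasurable.Diff[OF Um Vm])
    have "(norm (abs_l2 (\<lambda>x. indicator (V n) x - indicator A x :: real)))\<^sup>2
        = (LINT x|lebesgue. (indicator (V n) x - indicator A x :: real)\<^sup>2)"
      by (simp add: norm_abs_l2 square_integrable_diff sqV sqA)
    also have "\<dots> \<le> (LINT x|lebesgue. indicator (U - V n) x + indicator (U - A) x)"
      using square_integrable_diff[OF sqV sqA] UV U(3)
      by (intro integral_mono ind Bochner_Integration.integrable_add)
         (auto simp: square_integrable_def fmeasurable_def)
    also have "\<dots> = measure lebesgue (U - V n) + measure lebesgue (U - A)"
      using UV U(3) by (subst Bochner_Integration.integral_add) (auto simp: fmeasurable_def)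
    also have "\<dots> < e\<^sup>2" using mUV mUA \<open>d > 0\<close> unfolding d_def by linarith
    finally have "norm (abs_l2 (\<lambda>x. indicator (V n) x - indicator A x :: real)) < e"
      by (rule power_less_imp_less_base) (use \<open>e > 0\<close> in simp)
    then have "dist (abs_l2 (indicator (V n))) (abs_l2 (indicator A)) < e"
      by (simp add: dist_norm abs_l2_diff sqV sqA)
    moreover have "abs_l2 (indicator (V n)) \<in> S"
    proof -
      have "V n = \<Union>(C ` {..n} - {{}})" by (auto simp: V_def)
      moreover have "C ` {..n} - {{}} \<subseteq> B" using C B'(1) by auto
      ultimately show ?thesis using fin[of "C ` {..n} - {{}}"] Vm[of n] by auto
    qed
    ultimately show ?thesis by blast
  qed
  then show ?thesis unfolding closed_approachable[OF S, symmetric] by blast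
qed

lemma dense_abs_l2:
  fixes S :: "'a::euclidean_space l2 set"
  assumes S: "closed S" "0 \<in> S" "\<And>u v. u \<in> S \<Longrightarrow> v \<in> S \<Longrightarrow> u + v \<in> S" "\<And>c u. u \<in> S \<Longrightarrow> c *\<^sub>R u \<in> S"
    and ind: "\<And>A. A \<in> lmeasurable \<Longrightarrow> abs_l2 (indicator A) \<in> S"
  shows "u \<in> S"
proof -
  obtain f where f: "square_integrable f" "u = abs_l2 f" by (rule abs_l2_cases)
  have [measurable]: "f \<in> borel_measurable lebesgue" using f by (simp add: square_integrable_def)
  obtain F where F: "\<And>i. simple_function lebesgue (F i)" "\<And>x. (\<lambda>i. F i x) \<longlonglongrightarrow> f x"
      "\<And>i x. \<bar>F i x\<bar> \<le> 2 * \<bar>f x\<bar>"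
    using borel_measurable_implies_sequence_metric[of f lebesgue 0] by auto
  have [measurable]: "F i \<in> borel_measurable lebesgue" for i
    by (rule borel_measurable_simple_function[OF F(1)])
  have sqF: "square_integrable (F i)" for i
    by (rule square_integrable_mono[OF _ square_integrable_scale[OF f(1), of 2]])
       (use F(3)[of i] in \<open>simp_all add: abs_mult\<close>)
  have FS: "abs_l2 (F i) \<in> S" for i
  proof -
    let ?A = "\<lambda>y. F i -` {y}"
    let ?R = "range (F i) - {0}"
    have finR: "finite ?R" using simple_functionD(1)[OF F(1), of i] by simp
    have meas: "?A y \<in> sets lebesgue" for y
      using simple_functionD(2)[OF F(1), of i "{y}"] by simp
    have Am: "?A y \<in> lmeasurable" if "y \<in> ?R" for y
    proof -
      have "integrable lebesgue (\<lambda>x. (F i x)\<^sup>2 / y\<^sup>2)"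
        using sqF[of i] by (simp add: square_integrable_def)
      then have "integrable lebesgue (indicator (?A y) :: 'a \<Rightarrow> real)"
        by (rule Bochner_Integration.integrable_bound)
           (use meas that in \<open>auto simp: indicator_def\<close>)
      then show ?thesis using meas by (simp add: fmeasurable_def integrable_indicator_iff)
    qed
    have sqi: "square_integrable (\<lambda>x. y * indicator (?A y) x)" if "y \<in> ?R" for y
      by (intro square_integrable_scale square_integrable_indicator Am that)
    have eq: "F i = (\<lambda>x. \<Sum>y\<in>?R. y * indicator (?A y) x)"
    proof
      fix x
      have "(\<Sum>y\<in>?R. y * indicator (?A y) x) = (\<Sum>y\<in>?R. if y = F i x then y else 0)"
        by (intro sum.cong) (auto simp: indicator_def)
      also have "\<dots> = F i x" by (subst sum.delta[OF finR]) auto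
      finally show "F i x = (\<Sum>y\<in>?R. y * indicator (?A y) x)" by (rule sym)
    qed
    have "abs_l2 (F i) = abs_l2 (\<lambda>x. \<Sum>y\<in>?R. y * indicator (?A y) x)"
      using eq by (rule arg_cong)
    also have "\<dots> = (\<Sum>y\<in>?R. abs_l2 (\<lambda>x. y * indicator (?A y) x))"
      by (rule abs_l2_sum[OF finR sqi, THEN conjunct2, symmetric])
    also have "\<dots> = (\<Sum>y\<in>?R. y *\<^sub>R abs_l2 (indicator (?A y)))"
      by (intro sum.cong refl abs_l2_scale[symmetric] square_integrable_indicator Am)
    also have "\<dots> \<in> S"
    proof -
      have "(\<Sum>y\<in>T. y *\<^sub>R abs_l2 (indicator (?A y))) \<in> S" if "finite T" "T \<subseteq> ?R" for T
        using that
      proof (induction T)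
        case empty
        then show ?case by (simp add: S(2))
      next
        case (insert y T)
        then have "abs_l2 (indicator (?A y)) \<in> S" by (intro ind Am) simp
        then show ?case using insert by (simp add: S(3,4))
      qed
      then show ?thesis using finR by blast
    qed
    finally show ?thesis .
  qed
  have "(\<lambda>i. LINT x|lebesgue. (F i x - f x)\<^sup>2) \<longlonglongrightarrow> (LINT x|(lebesgue :: 'a measure). 0)"
  proof (rule integral_dominated_convergence)
    show "integrable lebesgue (\<lambda>x. 9 * (f x)\<^sup>2)" using f(1) by (simp add: square_integrable_def)
    show "AE x in lebesgue. (\<lambda>i. (F i x - f x)\<^sup>2) \<longlonglongrightarrow> 0"
    proof (rule AE_I2)
      fix x
      have "(\<lambda>i. (F i x - f x)\<^sup>2) \<longlonglongrightarrow> (f x - f x)\<^sup>2" by (intro tendsto_intros F)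
      then show "(\<lambda>i. (F i x - f x)\<^sup>2) \<longlonglongrightarrow> 0" by simp
    qed
    fix i
    have "(F i x - f x)\<^sup>2 \<le> 9 * (f x)\<^sup>2" for x
    proof -
      have "\<bar>F i x - f x\<bar> \<le> \<bar>3 * f x\<bar>" using F(3)[of i x] by auto
      from abs_le_square_iff[THEN iffD1, OF this] show ?thesis by (simp add: power_mult_distrib)
    qed
    then show "AE x in lebesgue. norm ((F i x - f x)\<^sup>2) \<le> 9 * (f x)\<^sup>2" by simp
  qed measurable
  then have "(\<lambda>i. sqrt (LINT x|lebesgue. (F i x - f x)\<^sup>2)) \<longlonglongrightarrow> sqrt 0"
    by (intro tendsto_real_sqrt) simp
  then have "(\<lambda>i. dist (abs_l2 (F i)) u) \<longlonglongrightarrow> 0"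
    by (simp add: f(2) dist_norm abs_l2_diff f(1) sqF norm_abs_l2 square_integrable_diff)
  then have "(\<lambda>i. abs_l2 (F i)) \<longlonglongrightarrow> u" by (rule tendsto_dist_iff[THEN iffD2])
  then show ?thesis by (rule closed_sequentially[OF S(1) FS])
qed

instance l2 :: (euclidean_space) second_countable_topology
proof
  obtain B :: "'a set set" where B: "countable B" "topological_basis B"
    using ex_countable_basis by blast
  define G where "G = {F. finite F \<and> F \<subseteq> B \<and> \<Union>F \<in> lmeasurable}"
  have cG: "countable G"
    unfolding G_def by (rule countable_subset[OF _ countable_Collect_finite_subset[OF B(1)]]) auto
  define comb where "comb = (\<lambda>xs :: (rat \<times> 'a set set) list.
      \<Sum>(q, F)\<leftarrow>xs. of_rat q *\<^sub>R abs_l2 (indicator (\<Union>F) :: 'a \<Rightarrow> real))"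
  define D where "D = comb ` lists (UNIV \<times> G)"
  have cD: "countable D"
    unfolding D_def by (intro countable_image countable_lists countable_SIGMA cG) auto
  have D0: "0 \<in> D" unfolding D_def by (rule image_eqI[where x="[]"]) (auto simp: comb_def)
  have Dadd: "u + v \<in> D" if "u \<in> D" "v \<in> D" for u v
  proof -
    obtain xs ys where "u = comb xs" "v = comb ys" "xs \<in> lists (UNIV \<times> G)" "ys \<in> lists (UNIV \<times> G)"
      using \<open>u \<in> D\<close> \<open>v \<in> D\<close> by (auto simp: D_def)
    then show ?thesis unfolding D_def by (intro image_eqI[where x="xs @ ys"]) (auto simp: comb_def)
  qed
  have Dscale: "of_rat q *\<^sub>R u \<in> D" if "u \<in> D" for q u
  proof -
    obtain xs where xs: "u = comb xs" "xs \<in> lists (UNIV \<times> G)" using \<open>u \<in> D\<close> by (auto simp: D_def)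
    have "of_rat q *\<^sub>R comb xs = comb (map (\<lambda>(r, F). (q * r, F)) xs)"
      by (induction xs) (auto simp: comb_def scaleR_add_right of_rat_mult)
    then show ?thesis unfolding D_def xs(1)
      by (rule image_eqI) (use xs(2) in auto)
  qed
  have "u \<in> closure D" for u
  proof (rule dense_abs_l2)
    show "closed (closure D)" "0 \<in> closure D" using D0 closure_subset by auto
    show "u + v \<in> closure D" if uv: "u \<in> closure D" "v \<in> closure D" for u v
    proof -
      obtain x y where "\<forall>n. x n \<in> D" "x \<longlonglongrightarrow> u" "\<forall>n. y n \<in> D" "y \<longlonglongrightarrow> v"
        using uv unfolding closure_sequential by blast
      then have "\<forall>n. x n + y n \<in> D" "(\<lambda>n. x n + y n) \<longlonglongrightarrow> u + v"
        using Dadd by (auto intro: tendsto_add)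
      then show ?thesis unfolding closure_sequential by (intro exI conjI)
    qed
    show "c *\<^sub>R u \<in> closure D" if uc: "u \<in> closure D" for c u
    proof -
      obtain x where x: "\<forall>n. x n \<in> D" "x \<longlonglongrightarrow> u"
        using uc unfolding closure_sequential by blast
      have "\<exists>q. c < of_rat q \<and> of_rat q < c + 1 / Suc n" for n
        using of_rat_dense[of c "c + 1 / Suc n"] by auto
      then have "\<exists>q. \<forall>n. c < of_rat (q n) \<and> of_rat (q n) < c + 1 / Suc n"
        by (intro choice allI)
      then obtain q where q: "\<And>n. c < of_rat (q n)" "\<And>n. of_rat (q n) < c + 1 / Suc n"
        by blast
      have "(\<lambda>n. of_rat (q n)) \<longlonglongrightarrow> c"
      proof (rule tendsto_sandwich)
        show "(\<lambda>n. c) \<longlonglongrightarrow> c" by simp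
        show "(\<lambda>n. c + 1 / Suc n) \<longlonglongrightarrow> c"
          using tendsto_add[OF tendsto_const[of c] LIMSEQ_inverse_real_of_nat] by (simp add: inverse_eq_divide)
      qed (rule always_eventually, rule allI, rule less_imp_le, rule q)+
      then have "\<forall>n. of_rat (q n) *\<^sub>R x n \<in> D" "(\<lambda>n. of_rat (q n) *\<^sub>R x n) \<longlonglongrightarrow> c *\<^sub>R u"
        using x Dscale by (auto intro: tendsto_scaleR)
      then show ?thesis unfolding closure_sequential by (intro exI conjI)
    qed
    show "abs_l2 (indicator A) \<in> closure D" if "A \<in> lmeasurable" for A
    proof (rule dense_abs_l2_indicator[OF B(2,1) closed_closure _ that])
      fix F assume "finite F" "F \<subseteq> B" "\<Union>F \<in> lmeasurable"
      then have "F \<in> G" by (simp add: G_def)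
      then have "abs_l2 (indicator (\<Union>F)) \<in> D" unfolding D_def
        by (intro image_eqI[where x="[(1, F)]"]) (auto simp: comb_def)
      then show "abs_l2 (indicator (\<Union>F)) \<in> closure D" using closure_subset by blast
    qed
  qed
  then have dense: "\<exists>d\<in>D. dist d u < e" if "e > 0" for u e
    using that by (simp add: closure_approachable)
  define BB where "BB = (\<lambda>(d, q). ball d (of_rat q)) ` (D \<times> (UNIV :: rat set))"
  have "countable BB"
    unfolding BB_def by (intro countable_image countable_SIGMA cD) auto
  moreover have "topological_basis BB"
  proof (rule topological_basisI)
    show "open b" if "b \<in> BB" for b using that by (auto simp: BB_def)
    fix U :: "'a l2 set" and u assume "open U" "u \<in> U"
    then obtain e where e: "e > 0" "ball u e \<subseteq> U" by (meson openE)
    obtain q where q: "0 < real_of_rat q" "real_of_rat q < e / 2"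
      using of_rat_dense[of 0 "e/2"] e(1) by auto
    obtain d where d: "d \<in> D" "dist d u < of_rat q" using dense[OF q(1)] by blast
    have "ball d (of_rat q) \<subseteq> ball u e"
    proof
      fix v assume "v \<in> ball d (of_rat q)"
      then have "dist u v < of_rat q + of_rat q"
        using d(2) dist_triangle[of u v d] by (simp add: dist_commute)
      then show "v \<in> ball u e" using q(2) by simp
    qed
    moreover have "u \<in> ball d (of_rat q)" using d(2) by simp
    moreover have "ball d (of_rat q) \<in> BB" using d(1) by (auto simp: BB_def)
    ultimately show "\<exists>b\<in>BB. u \<in> b \<and> b \<subseteq> U" using e(2) by blast
  qed
  ultimately show "\<exists>B :: 'a l2 set set. countable B \<and> open = generate_topology B"
    using topological_basis_imp_subbasis by blast
qed

section \<open>Domains\<close>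

definition L2 :: "'a::euclidean_space set \<Rightarrow> 'a l2 set" where
  "L2 \<Omega> = {u. AE x in lebesgue. x \<notin> \<Omega> \<longrightarrow> rep_l2 u x = 0}"

text \<open>
  Near every boundary point the set is, after a rotation, the strict epigraph of a Lipschitz
  function: \<open>e\<close> is the vertical unit direction, and \<open>\<gamma>\<close> is a function of the \<open>DIM('a) - 1\<close> coordinates
  orthogonal to \<open>e\<close>.
\<close>

definition lipschitz_boundary :: "'a::euclidean_space set \<Rightarrow> bool" where
  "lipschitz_boundary \<Omega> \<longleftrightarrow>
     (\<forall>p\<in>frontier \<Omega>. \<exists>e r L \<gamma>. norm e = 1 \<and> 0 < r \<and> L-lipschitz_on {y. y \<bullet> e = 0} \<gamma> \<and>
        \<Omega> \<inter> ball p r = {x \<in> ball p r. \<gamma> (x - (x \<bullet> e) *\<^sub>R e) < x \<bullet> e})"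

section \<open>Total variation and its subdifferential\<close>

text \<open>\<open>Ck k f\<close>: the function \<open>f\<close> is \<open>k\<close> times continuously differentiable on the whole space.\<close>

primrec Ck :: "nat \<Rightarrow> ('a::euclidean_space \<Rightarrow> 'b::real_normed_vector) \<Rightarrow> bool" where
  "Ck 0 f \<longleftrightarrow> continuous_on UNIV f"
| "Ck (Suc k) f \<longleftrightarrow> f differentiable_on UNIV \<and>
     (\<forall>i\<in>Basis. Ck k (\<lambda>x. frechet_derivative f (at x) i))"

text \<open>Smooth functions with compact support in \<open>\<Omega>\<close>, extended by zero to the whole space.\<close>

definition test_funs :: "'a::euclidean_space set \<Rightarrow> ('a \<Rightarrow> 'b::real_normed_vector) set" where
  "test_funs \<Omega> = {v. (\<forall>k. Ck k v) \<and> (\<exists>K. compact K \<and> K \<subseteq> \<Omega> \<and> (\<forall>x. x \<notin> K \<longrightarrow> v x = 0))}"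

definition divergence :: "('a::euclidean_space \<Rightarrow> 'a) \<Rightarrow> 'a \<Rightarrow> real" where
  "divergence v x = (\<Sum>i\<in>Basis. frechet_derivative v (at x) i \<bullet> i)"

definition variation :: "'a::euclidean_space set \<Rightarrow> ('a \<Rightarrow> real) \<Rightarrow> ereal" where
  "variation \<Omega> f = (SUP v\<in>{v \<in> test_funs \<Omega>. \<forall>x\<in>\<Omega>. norm (v x) \<le> 1}.
     ereal (LINT x:\<Omega>|lebesgue. f x * divergence v x))"

definition BV :: "'a::euclidean_space set \<Rightarrow> ('a \<Rightarrow> real) set" where
  "BV \<Omega> = {f. set_integrable lebesgue \<Omega> f \<and>
     ereal (LINT x:\<Omega>|lebesgue. \<bar>f x\<bar>) + variation \<Omega> f < \<infinity>}"

definition TV :: "'a::euclidean_space set \<Rightarrow> 'a l2 \<Rightarrow> ereal" where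
  "TV \<Omega> u = (if rep_l2 u \<in> BV \<Omega> then variation \<Omega> (rep_l2 u) else \<infinity>)"

text \<open>
  The subdifferential of an extended real functional in the Hilbert space formed by the closed
  subspace \<open>H\<close> of the ambient inner product space. Where a proper functional is infinite, it is empty.
\<close>

definition subdifferential :: "'b::real_inner set \<Rightarrow> ('b \<Rightarrow> ereal) \<Rightarrow> 'b \<Rightarrow> 'b set" where
  "subdifferential H F u = {p \<in> H. u \<in> H \<and> (\<forall>v\<in>H. F u + ereal (p \<bullet> (v - u)) \<le> F v)}"

definition subdiff_TV :: "'a::euclidean_space set \<Rightarrow> 'a l2 \<Rightarrow> 'a l2 set" where
  "subdiff_TV \<Omega> = subdifferential (L2 \<Omega>) (TV \<Omega>)"

definition dom_subdiff_TV :: "'a::euclidean_space set \<Rightarrow> 'a l2 set" where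
  "dom_subdiff_TV \<Omega> = {u \<in> L2 \<Omega>. subdiff_TV \<Omega> u \<noteq> {}}"

section \<open>The damped second-order flow\<close>

text \<open>
  Essentially bounded, strongly measurable curves on the half line \<open>[0, \<infinity>)\<close> with values almost
  everywhere in \<open>X\<close>. Only the values at times \<open>t \<ge> 0\<close> matter. The range space being separable,
  Borel measurability is strong measurability.
\<close>

definition Linf :: "'b::{banach, second_countable_topology} set \<Rightarrow> (real \<Rightarrow> 'b) set" where
  "Linf X = {u \<in> borel_measurable (lebesgue_on {0..}).
     (AE t in lebesgue_on {0..}. u t \<in> X) \<and> (\<exists>C. AE t in lebesgue_on {0..}. norm (u t) \<le> C)}"

text \<open>
  The curve \<open>w\<close> is the distributional time derivative of \<open>u\<close> on \<open>(0, \<infinity>)\<close>; the integrals are Bochner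
  integrals. This is used only for curves in \<^const>\<open>Linf\<close>, for which both integrands are integrable.
\<close>

definition time_derivative :: "(real \<Rightarrow> 'b::{banach, second_countable_topology}) \<Rightarrow> (real \<Rightarrow> 'b) \<Rightarrow> bool" where
  "time_derivative u w \<longleftrightarrow>
     (\<forall>\<phi>\<in>test_funs {0<..}. (LINT t:{0..}|lebesgue. deriv \<phi> t *\<^sub>R u t) = - (LINT t:{0..}|lebesgue. \<phi> t *\<^sub>R w t))"

definition W2_inf :: "'b::{banach, second_countable_topology} set \<Rightarrow>
    (real \<Rightarrow> 'b) \<Rightarrow> (real \<Rightarrow> 'b) \<Rightarrow> (real \<Rightarrow> 'b) \<Rightarrow> bool" where
  "W2_inf X u u' u'' \<longleftrightarrow> u \<in> Linf X \<and> u' \<in> Linf X \<and> u'' \<in> Linf X \<and>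
     time_derivative u u' \<and> time_derivative u' u''"

text \<open>
  Here \<open>u'\<close> is the first time derivative of \<open>u\<close>. Curves whose first two derivatives are essentially
  bounded have unique continuous representatives on \<open>[0, \<infinity>)\<close> together with their first derivative;
  \<open>u\<close> and \<open>u'\<close> are required to be these representatives, which gives meaning to the initial values and
  to the energy at each single time.
\<close>

definition weak_solution :: "'a::euclidean_space set \<Rightarrow> real \<Rightarrow> 'a l2 \<Rightarrow> 'a l2 \<Rightarrow>
    (real \<Rightarrow> 'a l2) \<Rightarrow> (real \<Rightarrow> 'a l2) \<Rightarrow> bool" where
  "weak_solution \<Omega> \<eta> u\<^sub>0 v\<^sub>0 u u' \<longleftrightarrow>
     u \<in> Linf (dom_subdiff_TV \<Omega>) \<and> continuous_on {0..} u \<and> continuous_on {0..} u' \<and>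
     u 0 = u\<^sub>0 \<and> u' 0 = v\<^sub>0 \<and>
     (\<exists>u''. W2_inf (L2 \<Omega>) u u' u'' \<and>
        (AE t in lebesgue_on {0..}. \<exists>p\<in>subdiff_TV \<Omega> (u t). u'' t + \<eta> *\<^sub>R u' t + p = 0))"

definition energy :: "'a::euclidean_space set \<Rightarrow> (real \<Rightarrow> 'a l2) \<Rightarrow> (real \<Rightarrow> 'a l2) \<Rightarrow> real \<Rightarrow> ereal" where
  "energy \<Omega> u u' t = ereal (1/2 * (norm (u' t))\<^sup>2) + TV \<Omega> (u t)"

end

theory Submission
  imports Defs
begin

text \<open>
  The reason why the flow cannot stop is that damping dissipates energy at most exponentially fast.
  Formally, multiplying the equation by \<open>u'\<close> shows that the energy \<open>E\<close> satisfies
  \<open>E' = - \<eta> (norm u')\<^sup>2 \<ge> - 2 \<eta> E\<close>, as the total variation is nonnegative. Hence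
  \<open>E t \<ge> E 0 * exp (- 2 \<eta> t)\<close>, and a positive initial energy stays positive. The argument
  is carried out for a nonnegative functional \<open>F\<close> on a Hilbert space and its subdifferential, in
  \<open>damped_subgradient_flow_backward_rest\<close>, and in contrapositive form: a solution at rest from time
  \<open>T\<close> on has zero energy at time 0.

  Making the formal computation rigorous takes three ingredients. The weak time derivatives of the
  solution have to be integrated back to increments (\<open>time_derivative_has_integral\<close>), for which the
  definition is tested with smooth trapezoids. The identity for the kinetic energy
  (\<open>kinetic_energy_identity\<close>) follows from an estimate of increments of second order. For the potential
  energy only the inequality \<open>F (u t) - F (u s) \<ge>\<close> integral of \<open>p \<bullet> u'\<close> with subgradients \<open>p\<close> is used
  (\<open>subgradient_chain_rule_ineq\<close>); it follows by averaging the subgradient inequality over small time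
  shifts. Since \<open>F\<close> is under control along the curve only at almost all times, it is replaced
  by the supremum of its affine minorants of bounded slope (\<open>affine_minorant_hull\<close>), which is
  Lipschitz. It agrees with \<open>F\<close> at almost all times, at time 0 because the initial datum has a
  subgradient, and at the rest point because that is a minimiser.
\<close>

section \<open>Smooth cutoff functions on the real line\<close>

text \<open>
  For \<open>p = 1\<close> this is the classical smooth function that is flat at the origin. The polynomial factor
  makes the family closed under differentiation.
\<close>

definition flat_exp :: "real poly \<Rightarrow> real \<Rightarrow> real" where
  "flat_exp p x = (if x \<le> 0 then 0 else poly p (1 / x) * exp (- (1 / x)))"

lemma poly_times_exp_decay: "((\<lambda>y. poly p y * exp (- y)) \<longlongrightarrow> (0::real)) at_top"
proof -
  have "((\<lambda>y. \<Sum>i\<le>degree p. coeff p i * (y ^ i / exp y)) \<longlongrightarrow> (\<Sum>i\<le>degree p. coeff p i * 0)) at_top"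
    by (intro tendsto_sum tendsto_mult tendsto_const tendsto_power_div_exp_0)
  then show ?thesis
    by (simp add: poly_altdef sum_distrib_right exp_minus divide_inverse mult.assoc)
qed

text \<open>
  Away from the origin this is the product rule, where \<open>1 / x\<^sup>2\<close> is the value of the polynomial
  \<open>[:0, 0, 1:]\<close> at \<open>1 / x\<close>. At the origin the difference quotient from the right is again a polynomial
  in \<open>1 / x\<close> times \<open>exp (- 1 / x)\<close>, which tends to zero.
\<close>

lemma flat_exp_has_derivative:
  "(flat_exp p has_real_derivative flat_exp ([:0, 0, 1:] * (p - pderiv p)) x) (at x)"
proof -
  consider "x < 0" | "x > 0" | "x = 0" by linarith
  then show ?thesis
  proof cases
    case 1
    have "((\<lambda>x. 0) has_real_derivative 0) (at x)" by simp
    then have "(flat_exp p has_real_derivative 0) (at x)"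
      by (rule has_field_derivative_transform_within_open[where S="{..<0}"])
        (use 1 in \<open>auto simp: flat_exp_def\<close>)
    then show ?thesis using 1 by (simp add: flat_exp_def)
  next
    case 2
    have "((\<lambda>x. poly p (1 / x) * exp (- (1 / x))) has_real_derivative
        poly (pderiv p) (1 / x) * (- 1 / x\<^sup>2) * exp (- (1 / x))
        + exp (- (1 / x)) * (1 / x\<^sup>2) * poly p (1 / x)) (at x)"
      using 2 by (auto intro!: derivative_eq_intros simp: power2_eq_square divide_simps) 
    then have "(flat_exp p has_real_derivative
        poly (pderiv p) (1 / x) * (- 1 / x\<^sup>2) * exp (- (1 / x))
        + exp (- (1 / x)) * (1 / x\<^sup>2) * poly p (1 / x)) (at x)"
      by (rule has_field_derivative_transform_within_open[where S="{0<..}"])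
        (use 2 in \<open>auto simp: flat_exp_def\<close>)
    moreover have "poly (pderiv p) (1 / x) * (- 1 / x\<^sup>2) * exp (- (1 / x))
        + exp (- (1 / x)) * (1 / x\<^sup>2) * poly p (1 / x)
        = flat_exp ([:0, 0, 1:] * (p - pderiv p)) x"
      using 2 by (simp add: flat_exp_def field_simps power2_eq_square)
    ultimately show ?thesis by simp
  next
    case 3
    have "((\<lambda>h. poly ([:0, 1:] * p) (inverse h) * exp (- inverse h)) \<longlongrightarrow> 0) (at_right 0)"
      by (rule filterlim_compose[OF poly_times_exp_decay filterlim_inverse_at_top_right])
    moreover have "\<forall>\<^sub>F h in at_right 0. poly ([:0, 1:] * p) (inverse h) * exp (- inverse h) = flat_exp p h / h"
      using eventually_at_right_less[of "0::real"]
      by eventually_elim (auto simp: flat_exp_def field_simps)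
    ultimately have R: "((\<lambda>h. flat_exp p h / h) \<longlongrightarrow> 0) (at_right 0)"
      by (rule Lim_transform_eventually)
    have "\<forall>\<^sub>F h in at_left (0::real). 0 = flat_exp p h / h"
      by (auto simp: eventually_at_filter flat_exp_def)
    then have L: "((\<lambda>h. flat_exp p h / h) \<longlongrightarrow> 0) (at_left 0)"
      by (rule Lim_transform_eventually[OF tendsto_const])
    show ?thesis
      using L R 3 by (simp add: DERIV_def filterlim_at_split flat_exp_def)
  qed
qed

text \<open>
  A class of functions in which every member has a derivative that is again a member consists of
  \<open>C\<^sup>\<infinity>\<close> functions. Generating the class inductively from the operations needed for a smooth
  trapezoid avoids proving closure of \<^const>\<open>Ck\<close> under each of these operations. The generators
  \<open>bump\<close> vanish outside the unit interval.
\<close>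

inductive cutoff_family :: "(real \<Rightarrow> real) \<Rightarrow> bool" where
  bump: "cutoff_family (\<lambda>x. flat_exp p x * flat_exp q (1 - x))"
| diff: "cutoff_family f \<Longrightarrow> cutoff_family g \<Longrightarrow> cutoff_family (\<lambda>x. f x - g x)"
| affine: "cutoff_family f \<Longrightarrow> cutoff_family (\<lambda>x. c * f (a * x + b))"
| antiderivative: "cutoff_family f \<Longrightarrow> (\<And>x. (g has_real_derivative f x) (at x)) \<Longrightarrow> cutoff_family g"

lemma cutoff_family_derivative:
  assumes "cutoff_family f"
  shows "\<exists>g. cutoff_family g \<and> (\<forall>x. (f has_real_derivative g x) (at x))"
  using assms
proof induction
  case (bump p q)
  define D where "D p = [:0, 0, 1:] * (p - pderiv p)" for p :: "real poly"
  have "cutoff_family (\<lambda>x. flat_exp (D p) x * flat_exp q (1 - x) - flat_exp p x * flat_exp (D q) (1 - x))"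
    by (intro cutoff_family.diff cutoff_family.bump)
  moreover have "((\<lambda>x. flat_exp p x * flat_exp q (1 - x)) has_real_derivative
      flat_exp (D p) x * flat_exp q (1 - x) - flat_exp p x * flat_exp (D q) (1 - x)) (at x)" for x
    using flat_exp_has_derivative[of p, folded D_def]
    by (auto intro!: derivative_eq_intros DERIV_chain2[OF flat_exp_has_derivative[of q, folded D_def]])
  ultimately show ?case by blast
next
  case (diff f g)
  then obtain f' g' where "cutoff_family f'" "\<And>x. (f has_real_derivative f' x) (at x)"
    "cutoff_family g'" "\<And>x. (g has_real_derivative g' x) (at x)" by blast
  then show ?case
    by (intro exI[of _ "\<lambda>x. f' x - g' x"]) (auto intro!: cutoff_family.diff derivative_intros)
next
  case (affine f c a b)
  then obtain f' where f': "cutoff_family f'" "\<And>x. (f has_real_derivative f' x) (at x)" by blast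
  have "((\<lambda>x. c * f (a * x + b)) has_real_derivative (c * a) * f' (a * x + b)) (at x)" for x
    by (auto intro!: derivative_eq_intros DERIV_chain2[OF f'(2)])
  then show ?case using cutoff_family.affine[OF f'(1), of "c * a" a b] by blast
next
  case (antiderivative f g)
  then show ?case by blast
qed

lemma frechet_derivative_real:
  "(f has_real_derivative D) (at x) \<Longrightarrow> frechet_derivative f (at x) 1 = D"
  using frechet_derivative_at[of f "(*) D" x] by (metis has_field_derivative_def mult.right_neutral)

lemma cutoff_family_Ck: "cutoff_family f \<Longrightarrow> Ck k f"
proof (induction k arbitrary: f)
  case 0
  then obtain g where "\<And>x. (f has_real_derivative g x) (at x)"
    using cutoff_family_derivative by blast
  then show ?case
    by (auto intro!: DERIV_continuous_on[where D=g] intro: has_field_derivative_at_within)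
next
  case (Suc k)
  then obtain g where g: "cutoff_family g" "\<And>x. (f has_real_derivative g x) (at x)"
    using cutoff_family_derivative by blast
  have "f differentiable_on UNIV"
    unfolding differentiable_on_def
    using g(2) has_field_derivative_imp_has_derivative differentiableI by blast
  moreover have "(\<lambda>x. frechet_derivative f (at x) 1) = g"
    using g(2) by (auto intro: frechet_derivative_real)
  ultimately show ?case using Suc.IH[OF g(1)] by simp
qed

text \<open>
  The step is the normalised antiderivative of the bump \<open>exp (- 1 / x) * exp (- 1 / (1 - x))\<close>
  on the unit interval.
\<close>

lemma smooth_unit_step:
  obtains \<Phi> \<rho> where "cutoff_family \<Phi>" "cutoff_family \<rho>"
    "\<And>x. (\<Phi> has_real_derivative \<rho> x) (at x)" "\<And>x. 0 \<le> \<rho> x"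
    "\<And>x. x \<le> 0 \<Longrightarrow> \<Phi> x = 0" "\<And>x. 1 \<le> x \<Longrightarrow> \<Phi> x = 1" "\<And>x. x \<le> 0 \<or> 1 \<le> x \<Longrightarrow> \<rho> x = 0"
proof -
  define r where "r x = flat_exp 1 x * flat_exp 1 (1 - x)" for x
  have Cr: "cutoff_family r" unfolding r_def by (rule cutoff_family.bump)
  have r0: "0 \<le> r x" for x by (auto simp: r_def flat_exp_def)
  have rz: "x \<le> 0 \<or> 1 \<le> x \<Longrightarrow> r x = 0" for x by (auto simp: r_def flat_exp_def)
  have cont: "continuous_on S r" for S
    using cutoff_family_Ck[OF Cr, of 0] by (auto intro: continuous_on_subset)
  define R where "R x = integral {-1..x} r" for x
  have Rz: "R x = 0" if "x \<le> 0" for x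
    unfolding R_def by (rule integral_unique, rule has_integral_is_0) (use that rz in auto)
  have dR: "(R has_real_derivative r x) (at x)" for x
  proof (cases "x < 0")
    case True
    have "((\<lambda>x. 0) has_real_derivative 0) (at x)" by simp
    then have "(R has_real_derivative 0) (at x)"
      by (rule has_field_derivative_transform_within_open[where S="{..<0}"]) (use True Rz in auto)
    then show ?thesis using True rz by simp
  next
    case False
    have "(R has_real_derivative r x) (at x within {-1..x+1})"
      unfolding R_def by (rule integral_has_real_derivative[OF cont]) (use False in auto)
    then show ?thesis
      using False at_within_Icc_at[of "-1" x "x+1"] by simp
  qed
  have CR: "cutoff_family R" using Cr dR by (rule cutoff_family.antiderivative)
  have R1: "R x = R 1" if "1 \<le> x" for x
  proof -
    have "R 1 + integral {1..x} r = R x"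
      unfolding R_def by (rule Henstock_Kurzweil_Integration.integral_combine)
        (use that in \<open>auto intro!: integrable_continuous_real cont\<close>)
    moreover have "integral {1..x} r = 0"
      by (rule integral_unique, rule has_integral_is_0) (use rz in auto)
    ultimately show ?thesis by simp
  qed
  have pos: "R 1 > 0"
  proof -
    have mono: "R a \<le> R b" if "a \<le> b" for a b
      by (rule DERIV_nonneg_imp_nondecreasing[OF that]) (use dR r0 in blast)
    have "R 0 \<le> R 1"
      by (rule mono) simp
    moreover have "R 1 \<noteq> 0"
    proof
      assume "R 1 = 0"
      have z: "R x = 0" if "0 < x" "x < 1" for x
      proof -
        have "R 0 \<le> R x" "R x \<le> R 1"
          using that by (auto intro: mono)
        then show ?thesis using \<open>R 1 = 0\<close> Rz[of 0] by simp
      qed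
      have "((\<lambda>x. 0) has_real_derivative 0) (at (1/2::real))" by simp
      then have "(R has_real_derivative 0) (at (1/2))"
        by (rule has_field_derivative_transform_within_open[where S="{0<..<1}"]) (use z in auto)
      then have "r (1/2) = 0" using dR DERIV_unique by blast
      then show False by (simp add: r_def flat_exp_def)
    qed
    ultimately show ?thesis using Rz[of 0] by simp
  qed
  show ?thesis
  proof (rule that[of "\<lambda>x. (1 / R 1) * R (1 * x + 0)" "\<lambda>x. (1 / R 1) * r (1 * x + 0)"])
    show "cutoff_family (\<lambda>x. (1 / R 1) * R (1 * x + 0))" "cutoff_family (\<lambda>x. (1 / R 1) * r (1 * x + 0))"
      by (rule cutoff_family.affine, fact)+
    show "((\<lambda>x. (1 / R 1) * R (1 * x + 0)) has_real_derivative (1 / R 1) * r (1 * x + 0)) (at x)" for x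
      using DERIV_cmult[OF dR[of x], of "1 / R 1"] by simp
    show "(1 / R 1) * r (1 * x + 0) \<ge> 0" for x using pos r0[of x] by simp
    show "(1 / R 1) * R (1 * x + 0) = 0" if "x \<le> 0" for x using Rz[OF that] by simp
    show "(1 / R 1) * R (1 * x + 0) = 1" if "1 \<le> x" for x using R1[OF that] pos by simp
    show "(1 / R 1) * r (1 * x + 0) = 0" if "x \<le> 0 \<or> 1 \<le> x" for x using rz[OF that] by simp
  qed
qed

section \<open>Integrating a distributional time derivative\<close>

text \<open>
  The difference of two steps rises from 0 to 1 just after \<open>s\<close> and falls back just after \<open>t\<close>. It is an
  admissible test function because \<open>s > 0\<close>, and it tends to the indicator of the interval from \<open>s\<close>
  to \<open>t\<close> as the slopes steepen.
\<close>

lemma trapezoid_test_fun: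
  assumes "cutoff_family \<Phi>" and "\<And>x. x \<le> 0 \<Longrightarrow> \<Phi> x = 0" and "\<And>x. 1 \<le> x \<Longrightarrow> \<Phi> x = 1"
    and "0 < s" "s \<le> t" "0 < n"
  shows "(\<lambda>x. \<Phi> (n * (x - s)) - \<Phi> (n * (x - t))) \<in> test_funs {0<..}"
proof -
  have "cutoff_family (\<lambda>x. 1 * \<Phi> (n * x + - (n * s)) - 1 * \<Phi> (n * x + - (n * t)))"
    by (intro cutoff_family.diff cutoff_family.affine assms)
  then have "cutoff_family (\<lambda>x. \<Phi> (n * (x - s)) - \<Phi> (n * (x - t)))"
    by (simp add: algebra_simps)
  moreover have "\<Phi> (n * (x - s)) - \<Phi> (n * (x - t)) = 0" if "x \<notin> {s..t + 1 / n}" for x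
  proof (cases "x < s")
    case True
    then have "n * (x - s) \<le> 0" "n * (x - t) \<le> 0"
      using assms by (auto simp: mult_le_0_iff)
    then show ?thesis using assms(2) by simp
  next
    case False
    then have "1 / n \<le> x - t" "1 / n \<le> x - s"
      using that assms by auto
    then have "1 \<le> n * (x - t)" "1 \<le> n * (x - s)"
      using \<open>0 < n\<close> by (auto simp: field_simps)
    then show ?thesis using assms(3) by simp
  qed
  moreover have "{s..t + 1 / n} \<subseteq> {0<..}" using \<open>0 < s\<close> by auto
  ultimately show ?thesis
    unfolding test_funs_def using cutoff_family_Ck compact_Icc by blast
qed

lemma measurable_bounded_integrable_on_Icc:
  fixes w :: "real \<Rightarrow> real"
  assumes "w \<in> borel_measurable (lebesgue_on {0..})" and "\<And>t. 0 \<le> t \<Longrightarrow> \<bar>w t\<bar> \<le> C" and "0 \<le> a"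
  shows "w absolutely_integrable_on {a..b}"
proof (rule measurable_bounded_by_integrable_imp_absolutely_integrable)
  show "w \<in> borel_measurable (lebesgue_on {a..b})"
    by (rule measurable_restrict_mono[OF assms(1)]) (use \<open>0 \<le> a\<close> in auto)
  show "(\<lambda>t. C) integrable_on {a..b}" by (rule integrable_const_ivl)
qed (use assms in auto)

lemma set_integral_eq_integral_Icc:
  fixes g :: "real \<Rightarrow> real"
  assumes "g absolutely_integrable_on {a..b}" and "0 \<le> a" and "\<And>x. x \<notin> {a..b} \<Longrightarrow> g x = 0"
  shows "(LINT x:{0..}|lebesgue. g x) = integral {a..b} g"
proof -
  have "(LINT x:{0..}|lebesgue. g x) = (LINT x:{a..b}|lebesgue. g x)"
    unfolding set_lebesgue_integral_def
    by (rule Bochner_Integration.integral_cong) (use assms(2,3) in \<open>auto simp: indicator_def\<close>)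
  then show ?thesis
    using set_lebesgue_integral_eq_integral(2)[OF assms(1)] by simp
qed

text \<open>
  The definition of the weak derivative is tested with increasingly steep trapezoids. The
  derivative of such a trapezoid is the difference of two approximate unit masses at \<open>s\<close> and \<open>t\<close>, so
  by continuity of \<open>f\<close> one side tends to \<open>f s - f t\<close>; the other side tends to minus the integral of
  \<open>w\<close> by dominated convergence.
\<close>

lemma time_derivative_has_integral_pos:
  fixes f w :: "real \<Rightarrow> real"
  assumes f: "continuous_on {0..} f"
    and w: "w \<in> borel_measurable (lebesgue_on {0..})" "\<And>t. 0 \<le> t \<Longrightarrow> \<bar>w t\<bar> \<le> C"
    and fw: "time_derivative f w" and s: "0 < s" "s \<le> t"
  shows "(w has_integral (f t - f s)) {s..t}"
proof -
  obtain \<Phi> \<rho> where step: "cutoff_family \<Phi>" "cutoff_family \<rho>"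
    "\<And>x. (\<Phi> has_real_derivative \<rho> x) (at x)" "\<And>x. 0 \<le> \<rho> x"
    "\<And>x. x \<le> 0 \<Longrightarrow> \<Phi> x = 0" "\<And>x. 1 \<le> x \<Longrightarrow> \<Phi> x = 1" "\<And>x. x \<le> 0 \<or> 1 \<le> x \<Longrightarrow> \<rho> x = 0"
    using smooth_unit_step by metis
  have mono: "\<Phi> a \<le> \<Phi> b" if "a \<le> b" for a b
    by (rule DERIV_nonneg_imp_nondecreasing[OF that]) (use step(3,4) in blast)
  have \<Phi>01: "0 \<le> \<Phi> x" "\<Phi> x \<le> 1" for x
    using mono[of 0 x] mono[of x 1] mono[of x 0] mono[of 1 x] step(5)[of 0] step(6)[of 1]
      step(5)[of x] step(6)[of x] by linarith+
  have cont: "continuous_on S \<Phi>" "continuous_on S \<rho>" for S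
    using cutoff_family_Ck[OF step(1), of 0] cutoff_family_Ck[OF step(2), of 0]
    by (auto intro: continuous_on_subset)
  define n where "n k = real (Suc k)" for k
  have n: "0 < n k" "1 \<le> n k" for k by (auto simp: n_def)
  define \<phi> where "\<phi> k x = \<Phi> (n k * (x - s)) - \<Phi> (n k * (x - t))" for k x
  define \<rho>' where "\<rho>' k a x = n k * \<rho> (n k * (x - a))" for k a x
  have test: "\<phi> k \<in> test_funs {0<..}" for k
    unfolding \<phi>_def by (rule trapezoid_test_fun) (use step s n in auto)
  have d\<Phi>: "((\<lambda>x. \<Phi> (n k * (x - a))) has_real_derivative \<rho>' k a x) (at x)" for k a x
  proof -
    have "((\<lambda>x. n k * (x - a)) has_real_derivative n k) (at x)"
      by (auto intro!: derivative_eq_intros)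
    from DERIV_chain2[OF step(3) this] show ?thesis
      unfolding \<rho>'_def by (simp add: mult.commute)
  qed
  have d\<phi>: "deriv (\<phi> k) x = \<rho>' k s x - \<rho>' k t x" for k x
    unfolding \<phi>_def by (rule DERIV_imp_deriv, rule DERIV_diff) (rule d\<Phi>)+
  have cont': "continuous_on S (\<rho>' k a)" for S k a
    unfolding \<rho>'_def
    by (intro continuous_intros continuous_on_compose2[OF cont(2)[of UNIV]]) auto
  have cont\<phi>: "continuous_on S (\<phi> k)" for S k
    unfolding \<phi>_def
    by (intro continuous_intros continuous_on_compose2[OF cont(1)[of UNIV]]) auto
  have outside: "n k * (x - a) \<le> 0 \<or> 1 \<le> n k * (x - a)" if "x \<notin> {a..a + 1 / n k}" for k a x
  proof (cases "x < a")
    case True then show ?thesis using n(1)[of k] by (simp add: mult_le_0_iff)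
  next
    case False
    then have "1 / n k \<le> x - a" using that by auto
    then show ?thesis using n(1)[of k] by (simp add: field_simps)
  qed
  have \<rho>'0: "\<rho>' k a x = 0" if "x \<notin> {a..a + 1 / n k}" for k a x
    unfolding \<rho>'_def using step(7)[OF outside[OF that]] by simp
  have n1: "1 / n k \<le> 1" for k using n[of k] by simp
  have \<phi>0: "\<phi> k x = 0" if "x \<notin> {s..t + 1}" for k x
  proof (cases "x < s")
    case True
    then have "n k * (x - s) \<le> 0" "n k * (x - t) \<le> 0"
      using s n[of k] by (auto simp: mult_le_0_iff)
    then show ?thesis using step(5) by (simp add: \<phi>_def)
  next
    case False
    then have "1 \<le> x - s" "1 \<le> x - t"
      using that s by auto
    then have "1 * 1 \<le> n k * (x - s)" "1 * 1 \<le> n k * (x - t)"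
      using n(2)[of k] by (intro mult_mono; simp)+
    then show ?thesis using step(6) by (simp add: \<phi>_def)
  qed
  have d\<phi>0: "deriv (\<phi> k) x = 0" if "x \<notin> {s..t + 1}" for k x
    unfolding d\<phi> using \<rho>'0[of x s k] \<rho>'0[of x t k] that n1[of k] s by auto
  have f': "continuous_on {s..t+1} f" using f s by (auto intro: continuous_on_subset)
  have wint: "w absolutely_integrable_on {s..t+1}"
    by (rule measurable_bounded_integrable_on_Icc[OF w]) (use s in auto)
  define A where "A k = integral {s..t+1} (\<lambda>x. deriv (\<phi> k) x * f x)" for k
  have contd: "continuous_on {s..t+1} (\<lambda>x. deriv (\<phi> k) x * f x)" for k
    unfolding d\<phi> by (intro continuous_intros cont' f')
  have \<phi>w: "(\<lambda>x. \<phi> k x * w x) absolutely_integrable_on {s..t+1}" for k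
    by (rule absolutely_integrable_bounded_measurable_product_real[OF _ _ _ wint])
      (auto intro!: continuous_imp_measurable_on_sets_lebesgue cont\<phi> compact_imp_bounded compact_continuous_image)
  have parts: "A k = - integral {s..t+1} (\<lambda>x. \<phi> k x * w x)" for k
  proof -
    have "(LINT x:{0..}|lebesgue. deriv (\<phi> k) x * f x) = A k"
      unfolding A_def
      by (rule set_integral_eq_integral_Icc)
        (use contd s d\<phi>0 in \<open>auto intro!: absolutely_integrable_continuous_real\<close>)
    moreover have "(LINT x:{0..}|lebesgue. \<phi> k x * w x) = integral {s..t+1} (\<lambda>x. \<phi> k x * w x)"
      by (rule set_integral_eq_integral_Icc) (use \<phi>w s \<phi>0 in auto)
    ultimately show ?thesis
      using fw test[of k] unfolding time_derivative_def by (simp only: real_scaleR_def)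
  qed
  \<comment> \<open>Near \<open>s\<close> and \<open>t\<close> the function \<open>f\<close> is within \<open>e / 3\<close> of its values there, and both masses
      are 1, so the total error is at most \<open>2 e / 3\<close>.\<close>
  have A_lim: "A \<longlonglongrightarrow> f s - f t"
  proof (rule LIMSEQ_I)
    fix e :: real assume "0 < e"
    have ev: "\<exists>d>0. \<forall>x\<in>{a..a+d}. \<bar>f x - f a\<bar> \<le> e / 3" if "0 \<le> a" for a
    proof -
      obtain d where d: "d > 0" "\<And>x. x \<in> {0..} \<Longrightarrow> dist x a < d \<Longrightarrow> dist (f x) (f a) < e / 3"
        using f[unfolded continuous_on_iff, rule_format, of a "e / 3"] \<open>0 < e\<close> \<open>0 \<le> a\<close> by auto
      show ?thesis
      proof (intro exI[of _ "d/2"] conjI ballI)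
        fix x assume "x \<in> {a..a + d/2}"
        then show "\<bar>f x - f a\<bar> \<le> e / 3"
          using d(2)[of x] d(1) \<open>0 \<le> a\<close> by (auto simp: dist_real_def)
      qed (use d in auto)
    qed
    obtain d1 d2 where d: "d1 > 0" "\<forall>x\<in>{s..s+d1}. \<bar>f x - f s\<bar> \<le> e / 3"
      "d2 > 0" "\<forall>x\<in>{t..t+d2}. \<bar>f x - f t\<bar> \<le> e / 3"
      using ev[of s] ev[of t] s by auto
    obtain N where N: "1 / real (Suc N) < min d1 d2"
      using nat_approx_posE[of "min d1 d2"] d(1,3) by auto
    have "\<bar>A k - (f s - f t)\<bar> < e" if "N \<le> k" for k
    proof -
      have small: "1 / n k < min d1 d2"
      proof (rule order.strict_trans1[OF _ N])
        show "1 / n k \<le> 1 / real (Suc N)"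
          unfolding n_def by (rule frac_le) (use that in auto)
      qed
      have I: "(\<rho>' k a has_integral 1) {s..t+1}" if a: "a = s \<or> a = t" for a
      proof -
        have "(\<rho>' k a has_integral \<Phi> (n k * (t + 1 - a)) - \<Phi> (n k * (s - a))) {s..t+1}"
          by (rule fundamental_theorem_of_calculus)
            (use s d\<Phi> in \<open>auto simp flip: has_real_derivative_iff_has_vector_derivative intro: has_field_derivative_at_within\<close>)
        moreover have "1 * 1 \<le> n k * (t + 1 - a)"
          using a s n[of k] by (intro mult_mono) auto
        moreover have "n k * (s - a) \<le> 0" using a s n[of k] by (auto simp: mult_le_0_iff)
        ultimately show ?thesis using step(5,6) by simp
      qed
      define g where "g x = deriv (\<phi> k) x * f x - (\<rho>' k s x * f s - \<rho>' k t x * f t)" for x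
      have "((\<lambda>x. \<rho>' k s x * f s - \<rho>' k t x * f t) has_integral 1 * f s - 1 * f t) {s..t+1}"
        by (intro has_integral_diff has_integral_mult_left I) auto
      moreover have "((\<lambda>x. deriv (\<phi> k) x * f x) has_integral A k) {s..t+1}"
        unfolding A_def by (intro integrable_integral integrable_continuous_real contd)
      ultimately have "(g has_integral A k - (1 * f s - 1 * f t)) {s..t+1}"
        unfolding g_def by (rule has_integral_diff[rotated])
      moreover have "((\<lambda>x. (e / 3) * (\<rho>' k s x + \<rho>' k t x)) has_integral (e / 3) * (1 + 1)) {s..t+1}"
        by (intro has_integral_mult_right has_integral_add I) auto
      moreover have "norm (g x) \<le> (e / 3) * (\<rho>' k s x + \<rho>' k t x)" for x
      proof -
        have pw: "\<bar>\<rho>' k a x * (f x - f a)\<bar> \<le> (e / 3) * \<rho>' k a x" if a: "a = s \<or> a = t" for a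
        proof (cases "x \<in> {a..a + 1 / n k}")
          case True
          have "\<bar>f x - f a\<bar> \<le> e / 3"
            using a
          proof
            assume "a = s"
            then have "x \<in> {s..s + d1}" using True small by auto
            then show ?thesis using d(2) \<open>a = s\<close> by blast
          next
            assume "a = t"
            then have "x \<in> {t..t + d2}" using True small by auto
            then show ?thesis using d(4) \<open>a = t\<close> by blast
          qed
          moreover have "0 \<le> \<rho>' k a x" using step(4) n(1)[of k] by (simp add: \<rho>'_def)
          ultimately have "\<bar>f x - f a\<bar> * \<bar>\<rho>' k a x\<bar> \<le> (e / 3) * \<rho>' k a x"
            by (intro mult_mono) (use \<open>0 < e\<close> in auto)
          then show ?thesis by (simp only: abs_mult mult.commute)
        qed (use \<rho>'0 in simp)
        have "g x = \<rho>' k s x * (f x - f s) - \<rho>' k t x * (f x - f t)"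
          unfolding g_def d\<phi> by (simp add: algebra_simps)
        then show ?thesis
          using pw[of s] pw[of t] by (simp add: distrib_left)
      qed
      ultimately have "norm (A k - (1 * f s - 1 * f t)) \<le> (e / 3) * (1 + 1)"
        using integral_norm_bound_integral[of g "{s..t+1}" "\<lambda>x. (e / 3) * (\<rho>' k s x + \<rho>' k t x)"]
        unfolding has_integral_iff by metis
      then show ?thesis using \<open>0 < e\<close> by auto
    qed
    then show "\<exists>N. \<forall>k\<ge>N. norm (A k - (f s - f t)) < e" by auto
  qed
  have lim: "(\<lambda>k. integral {s..t+1} (\<lambda>x. \<phi> k x * w x)) \<longlonglongrightarrow>
      integral {s..t+1} (\<lambda>x. (if s < x \<and> x \<le> t then 1 else 0) * w x)"
  proof (rule dominated_convergence(2)[where h="\<lambda>x. C"])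
    show "(\<lambda>x. \<phi> k x * w x) integrable_on {s..t+1}" for k
      using \<phi>w set_lebesgue_integral_eq_integral(1) by blast
    fix x assume x: "x \<in> {s..t+1}"
    have "\<bar>\<phi> k x\<bar> \<le> 1" for k
      using \<Phi>01[of "n k * (x - s)"] \<Phi>01[of "n k * (x - t)"] by (auto simp: \<phi>_def)
    then show "norm (\<phi> k x * w x) \<le> C" for k
      using w(2)[of x] x s mult_mono[of "\<bar>\<phi> k x\<bar>" 1 "\<bar>w x\<bar>" C] by (auto simp: abs_mult)
    have lim\<Phi>: "(\<lambda>k. \<Phi> (n k * (x - a))) \<longlonglongrightarrow> (if a < x then 1 else 0)" for a
    proof (cases "a < x")
      case True
      obtain N where N: "1 / real (Suc N) < x - a" using True nat_approx_posE[of "x - a"] by auto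
      have "\<Phi> (n k * (x - a)) = 1" if "N \<le> k" for k
      proof -
        have "1 / n k \<le> 1 / real (Suc N)"
          unfolding n_def by (rule frac_le) (use that in auto)
        then have "1 / n k \<le> x - a" using N by linarith
        then have "1 \<le> n k * (x - a)" using n(1)[of k] by (simp add: field_simps)
        then show ?thesis by (rule step(6))
      qed
      then show ?thesis using True by (auto intro!: tendsto_eventually eventually_sequentiallyI[of N])
    next
      case False
      then have "n k * (x - a) \<le> 0" for k using n(1)[of k] by (simp add: mult_le_0_iff)
      then show ?thesis using False step(5) by simp
    qed
    have "(\<lambda>k. \<phi> k x) \<longlonglongrightarrow> (if s < x then 1 else 0) - (if t < x then 1 else 0)"
      unfolding \<phi>_def by (intro tendsto_diff lim\<Phi>)
    also have "(if s < x then 1 else 0) - (if t < x then 1 else 0) = (if s < x \<and> x \<le> t then 1 else (0::real))"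
      using s by auto
    finally show "(\<lambda>k. \<phi> k x * w x) \<longlonglongrightarrow> (if s < x \<and> x \<le> t then 1 else 0) * w x"
      by (intro tendsto_mult tendsto_const)
  qed (rule integrable_const_ivl)
  have wst: "w integrable_on {s..t}"
    using measurable_bounded_integrable_on_Icc[OF w, of s t] s set_lebesgue_integral_eq_integral(1) by auto
  have "integral {s..t+1} (\<lambda>x. (if s < x \<and> x \<le> t then 1 else 0) * w x)
      = integral {s..t+1} (\<lambda>x. if x \<in> {s..t} then w x else 0)"
    by (rule integral_spike[of "{s}"]) auto
  also have "\<dots> = integral {s..t} w"
    by (simp only: integral_restrict_Int) (simp add: Int_absorb1)
  finally have "(\<lambda>k. - A k) \<longlonglongrightarrow> integral {s..t} w"
    using lim parts by simp
  then have "integral {s..t} w = - (f s - f t)"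
    by (rule LIMSEQ_unique[OF _ tendsto_minus[OF A_lim]])
  then show ?thesis using wst by (auto simp: has_integral_iff)
qed

text \<open>
  Test functions vanish near 0, so the left end point \<open>s = 0\<close> is reached by continuity of both sides.
\<close>

lemma time_derivative_has_integral:
  fixes f w :: "real \<Rightarrow> real"
  assumes f: "continuous_on {0..} f"
    and w: "w \<in> borel_measurable (lebesgue_on {0..})" "\<And>t. 0 \<le> t \<Longrightarrow> \<bar>w t\<bar> \<le> C"
    and fw: "time_derivative f w" and s: "0 \<le> s" "s \<le> t"
  shows "(w has_integral (f t - f s)) {s..t}"
proof (cases "s = t")
  case True
  then show ?thesis using has_integral_refl(2)[of w t] by simp
next
  case False
  have wint: "w integrable_on {a..b}" if "0 \<le> a" for a b
    using measurable_bounded_integrable_on_Icc[OF w that] set_lebesgue_integral_eq_integral(1) by blast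
  define G where "G x = f x - integral {s..x} w" for x
  have "G s = G t"
  proof (rule continuous_constant_on_closure[of "{s<..t}" G "G t" s])
    have "continuous_on {s..t} G"
      unfolding G_def using s
      by (intro continuous_intros indefinite_integral_continuous_1 wint continuous_on_subset[OF f]) auto
    then show "continuous_on (closure {s<..t}) G" using False s by simp
    show "s \<in> closure {s<..t}" using False s by simp
    fix x assume x: "x \<in> {s<..t}"
    have "integral {s..x} w + integral {x..t} w = integral {s..t} w"
      by (rule Henstock_Kurzweil_Integration.integral_combine) (use x s wint in auto)
    moreover have "integral {x..t} w = f t - f x"
      by (rule integral_unique, rule time_derivative_has_integral_pos[OF f w fw]) (use x s in auto)
    ultimately show "G x = G t" by (simp add: G_def)
  qed
  then show ?thesis using wint[OF s(1)] by (auto simp: G_def has_integral_iff)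
qed

lemma set_integrable_test_scale:
  fixes g :: "real \<Rightarrow> 'b::{banach, second_countable_topology}"
  assumes g: "g \<in> Linf X" and \<psi>: "continuous_on UNIV \<psi>" and K: "compact K" "\<And>x. x \<notin> K \<Longrightarrow> \<psi> x = 0"
  shows "set_integrable lebesgue {0..} (\<lambda>t. \<psi> t *\<^sub>R g t)"
proof -
  obtain a b where ab: "K \<subseteq> {a..b}"
    using compact_imp_bounded[OF K(1)] bounded_subset_cbox_symmetric by (metis cbox_interval)
  obtain C where C: "AE t in lebesgue_on {0..}. norm (g t) \<le> C" and [measurable]: "g \<in> borel_measurable (lebesgue_on {0..})"
    using g by (auto simp: Linf_def)
  have "\<psi> absolutely_integrable_on {a..b}"
    by (rule absolutely_integrable_continuous_real) (rule continuous_on_subset[OF \<psi>], simp)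
  moreover have "(\<lambda>x. indicator {a..b} x *\<^sub>R \<psi> x) = \<psi>"
    using K ab by (fastforce simp: indicator_def fun_eq_iff)
  ultimately have "integrable lebesgue \<psi>" by (simp add: set_integrable_def)
  then have "integrable lebesgue (\<lambda>x. indicator {0..} x *\<^sub>R \<psi> x)"
    by (intro integrable_mult_indicator) auto
  then have \<psi>i: "integrable (lebesgue_on {0..}) \<psi>"
    by (simp add: integrable_restrict_space)
  have "integrable (lebesgue_on {0..}) (\<lambda>t. \<psi> t *\<^sub>R g t)"
  proof (rule Bochner_Integration.integrable_bound)
    show "integrable (lebesgue_on {0..}) (\<lambda>t. C * \<psi> t)" using \<psi>i by simp
    show "(\<lambda>t. \<psi> t *\<^sub>R g t) \<in> borel_measurable (lebesgue_on {0..})"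
      using \<psi>i by measurable
    show "AE t in lebesgue_on {0..}. norm (\<psi> t *\<^sub>R g t) \<le> norm (C * \<psi> t)"
      using C
    proof eventually_elim
      case (elim t)
      then show ?case
        using mult_left_mono[of "norm (g t)" "\<bar>C\<bar>" "\<bar>\<psi> t\<bar>"] by (simp add: abs_mult mult.commute)
    qed
  qed
  then show ?thesis by (simp add: set_integrable_def integrable_restrict_space)
qed

text \<open>
  Pairing with a fixed vector reduces vector-valued weak derivatives to scalar ones; the vector can be
  moved out of the Bochner integrals because curves in \<^const>\<open>Linf\<close> times test functions are integrable.
\<close>

lemma time_derivative_inner:
  fixes f w :: "real \<Rightarrow> 'b::{real_inner, banach, second_countable_topology}"
  assumes "f \<in> Linf X" "w \<in> Linf Y" and fw: "time_derivative f w"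
  shows "time_derivative (\<lambda>t. f t \<bullet> c) (\<lambda>t. w t \<bullet> c)"
  unfolding time_derivative_def
proof
  fix \<phi> :: "real \<Rightarrow> real" assume \<phi>: "\<phi> \<in> test_funs {0<..}"
  then obtain K where K: "compact K" "\<And>x. x \<notin> K \<Longrightarrow> \<phi> x = 0"
    by (auto simp: test_funs_def)
  have Ck: "Ck 0 \<phi>" "Ck (Suc 0) \<phi>" using \<phi> by (auto simp: test_funs_def simp del: Ck.simps)
  have fd: "frechet_derivative \<phi> (at x) 1 = deriv \<phi> x" for x
  proof -
    have "\<phi> differentiable (at x)"
      using Ck(2) by (simp add: differentiable_on_def)
    then obtain D where "(\<phi> has_real_derivative D) (at x)" using real_differentiableE by blast
    then show ?thesis using frechet_derivative_real DERIV_imp_deriv by metis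
  qed
  have cont: "continuous_on UNIV \<phi>" "continuous_on UNIV (deriv \<phi>)"
    using Ck by (auto simp: fd)
  have d0: "deriv \<phi> x = 0" if "x \<notin> K" for x
  proof (rule DERIV_imp_deriv)
    have "((\<lambda>x. 0) has_real_derivative 0) (at x)" by simp
    then show "(\<phi> has_real_derivative 0) (at x)"
      by (rule has_field_derivative_transform_within_open[where S="- K"])
        (use K that in \<open>auto simp: compact_imp_closed\<close>)
  qed
  have pull: "(LINT t:{0..}|lebesgue. \<psi> t *\<^sub>R (g t \<bullet> c)) = (LINT t:{0..}|lebesgue. \<psi> t *\<^sub>R g t) \<bullet> c"
    if "g \<in> Linf Z" "continuous_on UNIV \<psi>" "\<And>x. x \<notin> K \<Longrightarrow> \<psi> x = 0" for \<psi> g Z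
  proof -
    have "integrable lebesgue (\<lambda>x. indicator {0..} x *\<^sub>R \<psi> x *\<^sub>R g x)"
      using set_integrable_test_scale[OF that(1,2) K(1) that(3)] by (simp add: set_integrable_def)
    from integral_inner_left[OF this, of c] show ?thesis
      unfolding set_lebesgue_integral_def by (simp add: mult.assoc)
  qed
  have "(LINT t:{0..}|lebesgue. deriv \<phi> t *\<^sub>R (f t \<bullet> c)) = (LINT t:{0..}|lebesgue. deriv \<phi> t *\<^sub>R f t) \<bullet> c"
    by (rule pull[OF assms(1) cont(2) d0])
  also have "\<dots> = - ((LINT t:{0..}|lebesgue. \<phi> t *\<^sub>R w t) \<bullet> c)"
    using fw[unfolded time_derivative_def, rule_format, OF \<phi>] by (simp only: inner_minus_left)
  also have "(LINT t:{0..}|lebesgue. \<phi> t *\<^sub>R w t) \<bullet> c = (LINT t:{0..}|lebesgue. \<phi> t *\<^sub>R (w t \<bullet> c))"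
    by (rule pull[OF assms(2) cont(1) K(2), symmetric])
  finally show "(LINT t:{0..}|lebesgue. deriv \<phi> t *\<^sub>R (f t \<bullet> c)) = - (LINT t:{0..}|lebesgue. \<phi> t *\<^sub>R (w t \<bullet> c))" .
qed

text \<open>
  This says that \<open>f\<close> is a primitive of \<open>g\<close> on the half line in the sense of the Pettis integral. Testing
  with vectors leaves only real integrals to handle, and norm bounds are recovered by choosing the test
  vector to be the increment itself.
\<close>

definition weak_primitive :: "(real \<Rightarrow> 'b::real_inner) \<Rightarrow> (real \<Rightarrow> 'b) \<Rightarrow> bool" where
  "weak_primitive f g \<longleftrightarrow>
     (\<forall>c s t. 0 \<le> s \<longrightarrow> s \<le> t \<longrightarrow> ((\<lambda>r. g r \<bullet> c) has_integral (f t - f s) \<bullet> c) {s..t})"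

lemma weak_primitiveD:
  "weak_primitive f g \<Longrightarrow> 0 \<le> s \<Longrightarrow> s \<le> t \<Longrightarrow> ((\<lambda>r. g r \<bullet> c) has_integral (f t - f s) \<bullet> c) {s..t}"
  by (simp add: weak_primitive_def)

lemma time_derivative_imp_weak_primitive:
  fixes f w :: "real \<Rightarrow> 'b::{real_inner, banach, second_countable_topology}"
  assumes f: "continuous_on {0..} f" "f \<in> Linf X" and w: "w \<in> Linf Y" "\<And>t. 0 \<le> t \<Longrightarrow> norm (w t) \<le> C"
    and fw: "time_derivative f w"
  shows "weak_primitive f w"
  unfolding weak_primitive_def
proof (intro allI impI)
  fix c s t assume st: "0 \<le> s" "s \<le> (t::real)"
  have [measurable]: "w \<in> borel_measurable (lebesgue_on {0..})"
    using w(1) by (simp add: Linf_def)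
  have "((\<lambda>r. w r \<bullet> c) has_integral (f t \<bullet> c - f s \<bullet> c)) {s..t}"
  proof (rule time_derivative_has_integral[where C="C * norm c"])
    show "continuous_on {0..} (\<lambda>r. f r \<bullet> c)" by (intro continuous_intros f)
    show "(\<lambda>r. w r \<bullet> c) \<in> borel_measurable (lebesgue_on {0..})" by measurable
    show "time_derivative (\<lambda>r. f r \<bullet> c) (\<lambda>r. w r \<bullet> c)" by (rule time_derivative_inner[OF f(2) w(1) fw])
    show "\<bar>w r \<bullet> c\<bar> \<le> C * norm c" if "0 \<le> r" for r
      using Cauchy_Schwarz_ineq2[of "w r" c] mult_right_mono[OF w(2)[OF that] norm_ge_zero[of c]] by linarith
  qed (use st in auto)
  then show "((\<lambda>r. w r \<bullet> c) has_integral (f t - f s) \<bullet> c) {s..t}"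
    by (simp add: inner_diff_left)
qed

text \<open>
  Let \<open>z\<close> be the vector whose norm is to be bounded. Testing with \<open>z\<close> gives
  \<open>(norm z)\<^sup>2 \<le> B * (t - s) * norm z\<close>. The case \<open>d = 0\<close> is the Lipschitz bound, and \<open>d = g s\<close> yields the
  first-order Taylor expansion of \<open>f\<close>.
\<close>

lemma weak_primitive_increment:
  assumes fg: "weak_primitive f g" and st: "0 \<le> s" "s \<le> t"
    and B: "\<And>r. s \<le> r \<Longrightarrow> r \<le> t \<Longrightarrow> norm (g r - d) \<le> B"
  shows "norm (f t - f s - (t - s) *\<^sub>R d) \<le> B * (t - s)"
proof -
  define z where "z = f t - f s - (t - s) *\<^sub>R d"
  have lower: "((\<lambda>r. g r \<bullet> z - d \<bullet> z) has_integral (f t - f s) \<bullet> z - (t - s) * (d \<bullet> z)) {s..t}"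
    by (intro has_integral_diff weak_primitiveD[OF fg] st)
      (use st has_integral_const_real[of "d \<bullet> z" s t] in simp)
  have upper: "((\<lambda>r. B * norm z) has_integral (t - s) * (B * norm z)) {s..t}"
    using st has_integral_const_real[of "B * norm z" s t] by simp
  have "g r \<bullet> z - d \<bullet> z \<le> B * norm z" if "r \<in> {s..t}" for r
    using norm_cauchy_schwarz[of "g r - d" z] mult_right_mono[OF B[of r] norm_ge_zero[of z]] that
    by (simp add: inner_diff_left)
  then have "(f t - f s) \<bullet> z - (t - s) * (d \<bullet> z) \<le> (t - s) * (B * norm z)"
    by (rule has_integral_le[OF lower upper])
  moreover have "(f t - f s) \<bullet> z - (t - s) * (d \<bullet> z) = z \<bullet> z"
    by (simp add: z_def inner_diff_left)
  ultimately have le: "norm z * norm z \<le> (t - s) * (B * norm z)"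
    by (simp add: dot_square_norm power2_eq_square)
  show ?thesis
  proof (cases "z = 0")
    case True
    have "0 \<le> B" using B[of s] st norm_ge_zero order_trans by blast
    then show ?thesis using True st by (simp add: z_def)
  next
    case False
    then have "0 < norm z" by simp
    have "norm z * norm z \<le> (B * (t - s)) * norm z" using le by (simp add: algebra_simps)
    then show ?thesis using \<open>0 < norm z\<close> by (simp add: z_def)
  qed
qed

lemma weak_primitive_Lipschitz:
  assumes "weak_primitive f g" and "0 \<le> s" "s \<le> t"
    and "\<And>r. s \<le> r \<Longrightarrow> r \<le> t \<Longrightarrow> norm (g r) \<le> B"
  shows "norm (f t - f s) \<le> B * (t - s)"
  using weak_primitive_increment[of f g s t 0 B] assms by simp

section \<open>Kinetic energy\<close>

lemma inner_absolutely_integrable_on_Icc: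
  fixes a b :: "real \<Rightarrow> 'b::{real_inner, second_countable_topology}"
  assumes [measurable]: "a \<in> borel_measurable (lebesgue_on {0..})" "b \<in> borel_measurable (lebesgue_on {0..})"
    and A: "\<And>r. s \<le> r \<Longrightarrow> r \<le> t \<Longrightarrow> norm (a r) \<le> A"
    and B: "\<And>r. s \<le> r \<Longrightarrow> r \<le> t \<Longrightarrow> norm (b r) \<le> B" and s: "0 \<le> s"
  shows "(\<lambda>r. a r \<bullet> b r) absolutely_integrable_on {s..t}"
proof (rule measurable_bounded_by_integrable_imp_absolutely_integrable)
  have "(\<lambda>r. a r \<bullet> b r) \<in> borel_measurable (lebesgue_on {0..})" by measurable
  then show "(\<lambda>r. a r \<bullet> b r) \<in> borel_measurable (lebesgue_on {s..t})"
    by (rule measurable_restrict_mono) (use s in auto)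
  show "(\<lambda>r. A * B) integrable_on {s..t}" by (rule integrable_const_ivl)
  fix r assume "r \<in> {s..t}"
  then have "norm (a r) * norm (b r) \<le> A * B"
    using A[of r] B[of r] order_trans[OF norm_ge_zero, of "a r" A] by (intro mult_mono) auto
  then show "norm (a r \<bullet> b r) \<le> A * B"
    using Cauchy_Schwarz_ineq2[of "a r" "b r"] by simp
qed simp

lemma quadratic_increments_imp_const:
  fixes F :: "real \<Rightarrow> real"
  assumes "s \<le> t" and K: "\<And>a b. s \<le> a \<Longrightarrow> a \<le> b \<Longrightarrow> b \<le> t \<Longrightarrow> \<bar>F b - F a\<bar> \<le> K * (b - a)\<^sup>2"
  shows "F s = F t"
proof -
  have "(F has_real_derivative 0) (at x within {s..t})" if x: "x \<in> {s..t}" for x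
    unfolding has_field_derivative_iff
  proof (rule Lim_null_comparison)
    have "((\<lambda>y. K * \<bar>y - x\<bar>) \<longlongrightarrow> K * \<bar>x - x\<bar>) (at x within {s..t})"
      by (intro tendsto_intros)
    then show "((\<lambda>y. K * \<bar>y - x\<bar>) \<longlongrightarrow> 0) (at x within {s..t})" by simp
    have "norm ((F y - F x) / (y - x)) \<le> K * \<bar>y - x\<bar>" if y: "y \<in> {s..t}" "y \<noteq> x" for y
    proof -
      have "\<bar>F y - F x\<bar> \<le> K * \<bar>y - x\<bar>\<^sup>2"
        using K[of x y] K[of y x] x y(1) by (cases "x \<le> y") (auto simp: abs_minus_commute power2_commute)
      then show ?thesis using y(2) by (simp add: divide_le_eq power2_eq_square mult.assoc)
    qed
    then show "\<forall>\<^sub>F y in at x within {s..t}. norm ((F y - F x) / (y - x)) \<le> K * \<bar>y - x\<bar>"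
      by (auto simp: eventually_at_filter)
  qed
  then obtain c where "\<forall>x\<in>{s..t}. F x = c"
    using has_field_derivative_zero_constant[of "{s..t}" F] by auto
  then show ?thesis using \<open>s \<le> t\<close> by auto
qed

text \<open>
  The chain rule for \<open>(norm (v r))\<^sup>2 / 2\<close> holds although \<open>w\<close> is merely bounded and measurable and \<open>v\<close> need not be
  differentiable at every point. On \<open>[a, b]\<close> the increment of \<open>(norm (v r))\<^sup>2 / 2\<close> is exactly the integral of
  \<open>w r \<bullet> m\<close> with the midpoint \<open>m\<close> of \<open>v a\<close> and \<open>v b\<close>. Replacing \<open>m\<close> by \<open>v r\<close> costs \<open>O((b - a)\<^sup>2)\<close>,
  as \<open>v\<close> is Lipschitz. A function whose increments are of quadratic order is constant.
\<close>

lemma kinetic_energy_identity: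
  fixes v w :: "real \<Rightarrow> 'b::{real_inner, second_countable_topology}"
  assumes vw: "weak_primitive v w"
    and meas: "v \<in> borel_measurable (lebesgue_on {0..})" "w \<in> borel_measurable (lebesgue_on {0..})"
    and C: "\<And>r. 0 \<le> r \<Longrightarrow> norm (w r) \<le> C" and V: "\<And>r. 0 \<le> r \<Longrightarrow> norm (v r) \<le> V"
    and st: "0 \<le> s" "s \<le> t"
  shows "((\<lambda>r. w r \<bullet> v r) has_integral ((norm (v t))\<^sup>2 - (norm (v s))\<^sup>2) / 2) {s..t}"
proof -
  have int: "(\<lambda>r. w r \<bullet> v r) integrable_on {a..b}" if "0 \<le> a" for a b
    using inner_absolutely_integrable_on_Icc[OF meas(2,1), of a b C V] C V that
      set_lebesgue_integral_eq_integral(1) by auto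
  have lip: "norm (v b - v a) \<le> C * (b - a)" if "0 \<le> a" "a \<le> b" for a b
    by (rule weak_primitive_Lipschitz[OF vw that]) (use C that in auto)
  have "0 \<le> C" using C[of 0] norm_ge_zero[of "w 0"] by linarith
  define F where "F x = (norm (v x))\<^sup>2 / 2 - integral {s..x} (\<lambda>r. w r \<bullet> v r)" for x
  have "F s = F t"
  proof (rule quadratic_increments_imp_const[OF st(2), where K="C * C"])
    fix a b assume ab: "s \<le> a" "a \<le> b" "b \<le> t"
    define m where "m = (1/2) *\<^sub>R (v a + v b)"
    have "integral {s..a} (\<lambda>r. w r \<bullet> v r) + integral {a..b} (\<lambda>r. w r \<bullet> v r) = integral {s..b} (\<lambda>r. w r \<bullet> v r)"
      by (rule Henstock_Kurzweil_Integration.integral_combine) (use ab st int in auto)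
    moreover have "(v b - v a) \<bullet> m = (norm (v b))\<^sup>2 / 2 - (norm (v a))\<^sup>2 / 2"
      by (simp add: m_def inner_diff_left inner_add_right power2_norm_eq_inner)
        (simp add: inner_commute field_simps)
    moreover have "((\<lambda>r. w r \<bullet> m - w r \<bullet> v r) has_integral
        (v b - v a) \<bullet> m - integral {a..b} (\<lambda>r. w r \<bullet> v r)) {a..b}"
      by (intro has_integral_diff weak_primitiveD[OF vw] integrable_integral int) (use ab st in auto)
    moreover from calculation have "(v b - v a) \<bullet> m - integral {a..b} (\<lambda>r. w r \<bullet> v r) = F b - F a"
      unfolding F_def by linarith
    ultimately have F: "((\<lambda>r. w r \<bullet> m - w r \<bullet> v r) has_integral F b - F a) {a..b}"
      by simp
    have "norm (w r \<bullet> m - w r \<bullet> v r) \<le> C * (C * (b - a))" if "r \<in> {a..b}" for r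
    proof -
      have "m - v r = (1/2) *\<^sub>R (v b - v r) - (1/2) *\<^sub>R (v r - v a)"
        by (simp add: m_def algebra_simps flip: scaleR_add_left)
      then have "norm (m - v r) \<le> (1/2) * norm (v b - v r) + (1/2) * norm (v r - v a)"
        using norm_triangle_ineq4[of "(1/2) *\<^sub>R (v b - v r)" "(1/2) *\<^sub>R (v r - v a)"] by simp
      also have "\<dots> \<le> (1/2) * (C * (b - r)) + (1/2) * (C * (r - a))"
        using lip[of r b] lip[of a r] that ab st by (intro add_mono mult_left_mono) auto
      also have "\<dots> \<le> C * (b - a)"
        using mult_nonneg_nonneg[OF \<open>0 \<le> C\<close>, of "b - a"] ab by (simp add: algebra_simps)
      finally have "norm (w r) * norm (m - v r) \<le> C * (C * (b - a))"
        using C[of r] that ab st \<open>0 \<le> C\<close> by (intro mult_mono) auto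
      then show ?thesis
        using Cauchy_Schwarz_ineq2[of "w r" "m - v r"] by (simp add: inner_diff_right)
    qed
    moreover have "0 \<le> C * (C * (b - a))" using \<open>0 \<le> C\<close> ab by simp
    ultimately have "norm (F b - F a) \<le> C * (C * (b - a)) * measure lborel (cbox a b)"
      using F by (intro has_integral_bound[where f="\<lambda>r. w r \<bullet> m - w r \<bullet> v r"]) auto
    then show "\<bar>F b - F a\<bar> \<le> C * C * (b - a)\<^sup>2"
      using ab by (simp add: power2_eq_square algebra_simps)
  qed
  then show ?thesis using int[OF st(1), of t] by (simp add: F_def has_integral_iff field_simps)
qed

section \<open>Potential energy along the flow\<close>

lemma AE_nonneg_reals_negligible:
  assumes "AE r in lebesgue_on {0::real..}. P r"
  obtains N where "negligible N" "\<And>r. 0 \<le> r \<Longrightarrow> r \<notin> N \<Longrightarrow> P r"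
proof -
  have "AE r in lebesgue. r \<in> {0..} \<longrightarrow> P r"
    using assms by (subst (asm) AE_restrict_space_iff) auto
  then obtain N where "N \<in> null_sets lebesgue" "{r \<in> space lebesgue. \<not> (r \<in> {0..} \<longrightarrow> P r)} \<subseteq> N"
    by (rule AE_E3) (auto simp: null_sets_def)
  then show ?thesis using that[of N] by (auto simp: negligible_iff_null_sets)
qed

text \<open>
  Only one half of the chain rule for a potential along a curve is required, and it needs no
  differentiation theorem. For almost every \<open>r\<close> the subgradient inequality at \<open>u r\<close>, evaluated at
  \<open>u (r + h)\<close>, bounds \<open>\<Phi> (u (r + h)) - \<Phi> (u r)\<close> from below by \<open>p r \<bullet> (u (r + h) - u r)\<close>, which is
  \<open>h * (p r \<bullet> v r)\<close> up to \<open>O(h\<^sup>2)\<close>. Integrated over \<open>r\<close>, the left-hand side telescopes to an integral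
  over \<open>[t, t + h]\<close> minus one over \<open>[s, s + h]\<close>, that is, to \<open>h * (\<Phi> (u t) - \<Phi> (u s))\<close> up to \<open>O(h\<^sup>2)\<close>.
  Dividing by \<open>h\<close> and letting \<open>h\<close> tend to 0 gives the claim.
\<close>

lemma subgradient_chain_rule_ineq:
  fixes u v w p :: "real \<Rightarrow> 'b::{real_inner, second_countable_topology}" and \<Phi> :: "'b \<Rightarrow> real"
  assumes lip: "\<And>x y. \<bar>\<Phi> x - \<Phi> y\<bar> \<le> M * norm (x - y)"
    and uv: "weak_primitive u v" and vw: "weak_primitive v w"
    and meas: "v \<in> borel_measurable (lebesgue_on {0..})" "p \<in> borel_measurable (lebesgue_on {0..})"
    and C: "\<And>r. 0 \<le> r \<Longrightarrow> norm (w r) \<le> C" and V: "\<And>r. 0 \<le> r \<Longrightarrow> norm (v r) \<le> V"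
    and M: "\<And>r. 0 \<le> r \<Longrightarrow> norm (p r) \<le> M"
    and sub: "AE r in lebesgue_on {0..}. \<forall>y. \<Phi> (u r) + p r \<bullet> (y - u r) \<le> \<Phi> y"
    and st: "0 \<le> s" "s \<le> t"
  shows "integral {s..t} (\<lambda>r. p r \<bullet> v r) \<le> \<Phi> (u t) - \<Phi> (u s)"
proof -
  obtain N where N: "negligible N"
    "\<And>r y. 0 \<le> r \<Longrightarrow> r \<notin> N \<Longrightarrow> \<Phi> (u r) + p r \<bullet> (y - u r) \<le> \<Phi> y"
    using AE_nonneg_reals_negligible[OF sub] by metis
  define \<phi> where "\<phi> r = \<Phi> (u r)" for r
  define I where "I = integral {s..t} (\<lambda>r. p r \<bullet> v r)"
  have C0: "0 \<le> C" and M0: "0 \<le> M" and V0: "0 \<le> V"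
    using C[of 0] M[of 0] V[of 0] norm_ge_zero[of "w 0"] norm_ge_zero[of "p 0"] norm_ge_zero[of "v 0"] by linarith+
  have int: "(\<lambda>r. p r \<bullet> v r) integrable_on {s..t}"
    using inner_absolutely_integrable_on_Icc[OF meas(2,1), of s t M V] M V st
      set_lebesgue_integral_eq_integral(1) by auto
  have lipu: "norm (u b - u a) \<le> V * (b - a)" if "0 \<le> a" "a \<le> b" for a b
    by (rule weak_primitive_Lipschitz[OF uv that]) (use V that in auto)
  have lip\<phi>: "\<bar>\<phi> b - \<phi> a\<bar> \<le> M * V * (b - a)" if "0 \<le> a" "a \<le> b" for a b
    using lip[of "u b" "u a"] mult_left_mono[OF lipu[OF that] M0] by (simp add: \<phi>_def mult.assoc)
  have lip\<phi>2: "(M * V)-lipschitz_on {0..} \<phi>"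
  proof (rule lipschitz_onI)
    fix x y :: real assume "x \<in> {0..}" "y \<in> {0..}"
    then show "dist (\<phi> x) (\<phi> y) \<le> M * V * dist x y"
      using lip\<phi>[of x y] lip\<phi>[of y x] by (cases "x \<le> y") (auto simp: dist_real_def abs_minus_commute)
  qed (use M0 V0 in simp)
  have cont: "continuous_on {a..b} \<phi>" if "0 \<le> a" for a b
    by (rule continuous_on_subset[OF lipschitz_on_continuous_on[OF lip\<phi>2]]) (use that in auto)
  have i\<phi>: "\<phi> integrable_on {a..b}" if "0 \<le> a" for a b
    by (rule integrable_continuous_real[OF cont[OF that]])
  have main: "I \<le> \<phi> t - \<phi> s + (2 * (M * V) + M * C * (t - s)) * h" if h: "0 < h" "h \<le> 1" for h
  proof -
    have lower: "h * (p r \<bullet> v r) - M * C * h\<^sup>2 \<le> \<phi> (r + h) - \<phi> r" if r: "0 \<le> r" "r \<notin> N" for r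
    proof -
      have "norm (u (r + h) - u r - (r + h - r) *\<^sub>R v r) \<le> (C * h) * (r + h - r)"
      proof (rule weak_primitive_increment[OF uv])
        fix x assume x: "r \<le> x" "x \<le> r + h"
        have "norm (v x - v r) \<le> C * (x - r)"
          by (rule weak_primitive_Lipschitz[OF vw]) (use C r x in auto)
        also have "\<dots> \<le> C * h" using x C0 by (intro mult_left_mono) auto
        finally show "norm (v x - v r) \<le> C * h" .
      qed (use r h in auto)
      then have "norm (p r) * norm (u (r + h) - u r - h *\<^sub>R v r) \<le> M * (C * h * h)"
        using M[OF r(1)] M0 by (intro mult_mono) auto
      then have "- (M * C * h\<^sup>2) \<le> p r \<bullet> (u (r + h) - u r - h *\<^sub>R v r)"
        using Cauchy_Schwarz_ineq2[of "p r" "u (r + h) - u r - h *\<^sub>R v r"]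
        by (simp add: power2_eq_square mult.assoc)
      moreover have "\<phi> r + p r \<bullet> (u (r + h) - u r) \<le> \<phi> (r + h)"
        using N(2)[OF r, of "u (r + h)"] by (simp add: \<phi>_def)
      ultimately show ?thesis by (simp add: inner_diff_right)
    qed
    define g where "g r = h * (p r \<bullet> v r) - M * C * h\<^sup>2" for r
    have "(g has_integral h * I - (t - s) * (M * C * h\<^sup>2)) {s..t}"
      unfolding g_def I_def
      by (intro has_integral_diff has_integral_mult_right integrable_integral int)
        (use st has_integral_const_real[of "M * C * h\<^sup>2" s t] in simp)
    \<comment> \<open>On the exceptional null set the integrand is replaced, so that the lower bound holds everywhere.\<close>
    then have g: "((\<lambda>r. if r \<in> N then \<phi> (r + h) - \<phi> r else g r) has_integral
        h * I - (t - s) * (M * C * h\<^sup>2)) {s..t}"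
      by (rule has_integral_spike[OF N(1), rotated]) auto
    have shift: "((\<lambda>r. \<phi> (r + h)) has_integral integral {s+h..t+h} \<phi>) {s..t}"
      using has_integral_shift_real_ivl[of \<phi> "integral {s+h..t+h} \<phi>" "s+h" "t+h" h] i\<phi>[of "s+h" "t+h"] st h
      by (simp add: integrable_integral)
    have "h * I - (t - s) * (M * C * h\<^sup>2) \<le> integral {s+h..t+h} \<phi> - integral {s..t} \<phi>"
      by (rule has_integral_le[OF g has_integral_diff[OF shift integrable_integral[OF i\<phi>[OF st(1)]]]])
        (use lower st in \<open>auto simp: g_def\<close>)
    also have "\<dots> = integral {t..t+h} \<phi> - integral {s..s+h} \<phi>"
    proof -
      have "integral {s..s+h} \<phi> + integral {s+h..t+h} \<phi> = integral {s..t+h} \<phi>"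
        "integral {s..t} \<phi> + integral {t..t+h} \<phi> = integral {s..t+h} \<phi>"
        by (rule Henstock_Kurzweil_Integration.integral_combine; use st h i\<phi> in auto)+
      then show ?thesis by simp
    qed
    also have "\<dots> \<le> h * (\<phi> t + M * V * h) - h * (\<phi> s - M * V * h)"
    proof (rule diff_mono)
      have near: "\<bar>\<phi> r - \<phi> a\<bar> \<le> M * V * h" if "0 \<le> a" "r \<in> {a..a+h}" for a r
        using lip\<phi>[of a r] that mult_left_mono[of "r - a" h "M * V"] M0 V0 by auto
      have const: "((\<lambda>x. c) has_integral h * c) {a..a+h}" for a c :: real
        using h has_integral_const_real[of c a "a+h"] by simp
      have bound: "\<phi> r \<le> \<phi> t + M * V * h" if "r \<in> {t..t+h}" for r
        using near[of t r] that st by auto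
      show "integral {t..t+h} \<phi> \<le> h * (\<phi> t + M * V * h)"
        by (rule has_integral_le[OF integrable_integral[OF i\<phi>] const]) (use st bound in auto)
      have bound': "\<phi> s - M * V * h \<le> \<phi> r" if "r \<in> {s..s+h}" for r
        using near[of s r] that st by auto
      show "h * (\<phi> s - M * V * h) \<le> integral {s..s+h} \<phi>"
        by (rule has_integral_le[OF const integrable_integral[OF i\<phi>]]) (use st bound' in auto)
    qed
    finally have "h * I \<le> h * (\<phi> t - \<phi> s + (2 * (M * V) + M * C * (t - s)) * h)"
      by (simp add: algebra_simps power2_eq_square)
    then show ?thesis using h(1) by simp
  qed
  define K where "K = 2 * (M * V) + M * C * (t - s)"
  have "0 \<le> K" unfolding K_def using C0 M0 V0 st by simp
  have "I \<le> \<phi> t - \<phi> s"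
  proof (rule field_le_epsilon)
    fix e :: real assume "0 < e"
    define h where "h = min 1 (e / (K + 1))"
    have h: "0 < h" "h \<le> 1" "h \<le> e / (K + 1)" using \<open>0 < e\<close> \<open>0 \<le> K\<close> by (auto simp: h_def)
    have "K * h \<le> (K + 1) * h" using h by (simp add: algebra_simps)
    also have "\<dots> \<le> e" using h(3) \<open>0 \<le> K\<close> by (simp add: field_simps)
    finally show "I \<le> \<phi> t - \<phi> s + e" using main[OF h(1,2)] by (simp add: K_def)
  qed
  then show ?thesis by (simp add: I_def \<phi>_def)
qed

section \<open>Lipschitz regularisation of a convex functional\<close>

text \<open>
  The subgradients met along the flow are bounded by a common constant \<open>M\<close>. The supremum of all affine
  minorants of \<open>F\<close> with slope at most \<open>M\<close> is a finite \<open>M\<close>-Lipschitz function that agrees with \<open>F\<close> at every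
  point where \<open>F\<close> has a subgradient of norm at most \<open>M\<close>, and inherits that subgradient. Passing to
  it gives a continuous potential along the curve, whereas \<open>F\<close> itself is under control only at almost
  every time.
\<close>

definition affine_minorant_hull :: "'b::real_inner set \<Rightarrow> ('b \<Rightarrow> ereal) \<Rightarrow> real \<Rightarrow> 'b \<Rightarrow> real" where
  "affine_minorant_hull H F M y =
     (SUP (x, q)\<in>{(x, q). q \<in> subdifferential H F x \<and> norm q \<le> M}. real_of_ereal (F x) + q \<bullet> (y - x))"

text \<open>
  The point \<open>z\<close> is a minimiser, at which \<open>0\<close> is a subgradient. It makes the family of minorants nonempty
  and keeps the supremum finite.
\<close>

context
  fixes H :: "'b::real_inner set" and F :: "'b \<Rightarrow> ereal" and M :: real and z :: 'b
  assumes F_nonneg: "\<And>x. 0 \<le> F x" and zH: "z \<in> H" and Fz: "F z = 0" and H0: "0 \<in> H" and M0: "0 \<le> M"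
begin

lemma subdifferential_finite:
  assumes "q \<in> subdifferential H F x"
  shows "F x = ereal (real_of_ereal (F x))"
proof -
  have "F x + ereal (q \<bullet> (z - x)) \<le> 0"
    using assms zH Fz by (auto simp: subdifferential_def)
  then have "F x \<noteq> \<infinity>" by auto
  then show ?thesis using F_nonneg[of x] by (cases "F x") auto
qed

lemma subgradient_real:
  assumes "q \<in> subdifferential H F x" "q' \<in> subdifferential H F x'"
  shows "real_of_ereal (F x) + q \<bullet> (x' - x) \<le> real_of_ereal (F x')"
proof -
  have "F x + ereal (q \<bullet> (x' - x)) \<le> F x'"
    using assms by (auto simp: subdifferential_def)
  then show ?thesis
    using subdifferential_finite[OF assms(1)] subdifferential_finite[OF assms(2)]
    by (metis ereal_less_eq(3) plus_ereal.simps(1))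
qed

lemma zero_subgradient: "0 \<in> subdifferential H F z"
  using F_nonneg zH H0 Fz by (simp add: subdifferential_def zero_ereal_def[symmetric])

lemma affine_minorant_bound:
  assumes "q \<in> subdifferential H F x" "norm q \<le> M"
  shows "real_of_ereal (F x) + q \<bullet> (y - x) \<le> real_of_ereal (F x) + q \<bullet> (y' - x) + M * norm (y - y')"
proof -
  have "q \<bullet> (y - y') \<le> norm q * norm (y - y')" by (rule norm_cauchy_schwarz)
  also have "\<dots> \<le> M * norm (y - y')" using assms(2) by (intro mult_right_mono) auto
  finally show ?thesis by (simp add: inner_diff_right)
qed

lemma bdd_above_affine_minorants:
  "bdd_above ((\<lambda>(x, q). real_of_ereal (F x) + q \<bullet> (y - x)) ` {(x, q). q \<in> subdifferential H F x \<and> norm q \<le> M})"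
proof (rule bdd_aboveI2, clarify)
  fix x q assume q: "q \<in> subdifferential H F x" "norm q \<le> M"
  show "real_of_ereal (F x) + q \<bullet> (y - x) \<le> M * norm (y - z)"
    using affine_minorant_bound[OF q, of y z] subgradient_real[OF q(1) zero_subgradient] Fz by simp
qed

lemma affine_minorant_hull_ge:
  assumes "q \<in> subdifferential H F x" "norm q \<le> M"
  shows "real_of_ereal (F x) + q \<bullet> (y - x) \<le> affine_minorant_hull H F M y"
  using cSUP_upper[OF _ bdd_above_affine_minorants, of "(x, q)" y] assms
  by (simp add: affine_minorant_hull_def)

lemma affine_minorant_hull_le:
  assumes "\<And>x q. q \<in> subdifferential H F x \<Longrightarrow> norm q \<le> M \<Longrightarrow> real_of_ereal (F x) + q \<bullet> (y - x) \<le> c"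
  shows "affine_minorant_hull H F M y \<le> c"
  unfolding affine_minorant_hull_def
  by (rule cSUP_least) (use assms zero_subgradient M0 in force)+

lemma affine_minorant_hull_Lipschitz:
  "\<bar>affine_minorant_hull H F M y - affine_minorant_hull H F M y'\<bar> \<le> M * norm (y - y')"
proof -
  have "affine_minorant_hull H F M y \<le> affine_minorant_hull H F M y' + M * norm (y - y')" for y y'
  proof (rule affine_minorant_hull_le)
    fix x q assume q: "q \<in> subdifferential H F x" "norm q \<le> M"
    show "real_of_ereal (F x) + q \<bullet> (y - x) \<le> affine_minorant_hull H F M y' + M * norm (y - y')"
      using affine_minorant_bound[OF q, of y y'] affine_minorant_hull_ge[OF q, of y'] by linarith
  qed
  from this[of y y'] this[of y' y] show ?thesis by (simp add: norm_minus_commute)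
qed

lemma affine_minorant_hull_eq:
  assumes "q \<in> subdifferential H F x" "norm q \<le> M"
  shows "ereal (affine_minorant_hull H F M x) = F x"
proof -
  have "affine_minorant_hull H F M x = real_of_ereal (F x)"
    using affine_minorant_hull_ge[OF assms, of x] affine_minorant_hull_le subgradient_real[OF _ assms(1)]
    by (intro antisym) auto
  then show ?thesis using subdifferential_finite[OF assms(1)] by simp
qed

lemma affine_minorant_hull_subgradient:
  assumes "q \<in> subdifferential H F x" "norm q \<le> M"
  shows "affine_minorant_hull H F M x + q \<bullet> (y - x) \<le> affine_minorant_hull H F M y"
  using affine_minorant_hull_ge[OF assms, of y] affine_minorant_hull_eq[OF assms]
  by (metis real_of_ereal.simps(1))

lemma affine_minorant_hull_nonneg: "0 \<le> affine_minorant_hull H F M y"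
  using affine_minorant_hull_ge[OF zero_subgradient, of y] M0 Fz by simp

lemma affine_minorant_hull_zero: "affine_minorant_hull H F M z = 0"
  using affine_minorant_hull_eq[OF zero_subgradient] M0 Fz by (simp add: zero_ereal_def)

end

section \<open>No extinction in finite time\<close>

text \<open>
  The function \<open>exp (k * s) * integral {s..T} g\<close> is nondecreasing, by the hypothesis, and vanishes at
  \<open>s = T\<close>.
\<close>

lemma backward_Gronwall:
  fixes g :: "real \<Rightarrow> real"
  assumes T: "0 \<le> T" and g: "continuous_on {0..T} g"
    and le: "\<And>s. 0 \<le> s \<Longrightarrow> s \<le> T \<Longrightarrow> g s \<le> k * integral {s..T} g"
  shows "integral {0..T} g \<le> 0"
proof -
  define G where "G s = integral {0..s} g" for s
  define y where "y s = exp (k * s) * (G T - G s)" for s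
  have int: "g integrable_on {a..b}" if "0 \<le> a" "b \<le> T" for a b
    by (rule integrable_continuous_real, rule continuous_on_subset[OF g]) (use that in auto)
  have tail: "integral {s..T} g = G T - G s" if "0 \<le> s" "s \<le> T" for s
    using Henstock_Kurzweil_Integration.integral_combine[OF that int[of 0 T]] by (simp add: G_def)
  have dG: "(G has_real_derivative g s) (at s within {0..T})" if "s \<in> {0..T}" for s
    unfolding G_def by (rule integral_has_real_derivative[OF g that])
  have "y 0 \<le> y T"
  proof (rule DERIV_nonneg_imp_increasing_open[OF T])
    fix s assume s: "0 < s" "s < T"
    have "(G has_real_derivative g s) (at s)"
      using dG[of s] s at_within_Icc_at[of 0 s T] by simp
    then have "(y has_real_derivative exp (k * s) * (k * (G T - G s) - g s)) (at s)"
      unfolding y_def by (auto intro!: derivative_eq_intros simp: algebra_simps)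
    moreover have "0 \<le> exp (k * s) * (k * (G T - G s) - g s)"
      using le[of s] tail[of s] s by simp
    ultimately show "\<exists>d. (y has_real_derivative d) (at s) \<and> 0 \<le> d" by blast
  next
    have "continuous_on {0..T} G" using dG by (rule DERIV_continuous_on)
    then show "continuous_on {0..T} y" unfolding y_def by (intro continuous_intros)
  qed
  then show ?thesis by (simp add: y_def G_def)
qed

text \<open>
  The acceleration is given only up to null sets; a bounded representative with the same weak
  properties allows pointwise estimates.
\<close>

lemma Linf_bounded_representative:
  assumes "w \<in> Linf X"
  obtains w' C where "w' \<in> borel_measurable (lebesgue_on {0..})" "\<And>r. norm (w' r) \<le> C"
    "AE r in lebesgue_on {0..}. w' r = w r"
proof -
  obtain C where C: "AE r in lebesgue_on {0..}. norm (w r) \<le> C"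
    and w[measurable]: "w \<in> borel_measurable (lebesgue_on {0..})"
    using assms by (auto simp: Linf_def)
  define w' where "w' r = (if norm (w r) \<le> \<bar>C\<bar> then w r else 0)" for r
  show ?thesis
  proof
    show "w' \<in> borel_measurable (lebesgue_on {0..})" unfolding w'_def by measurable
    show "norm (w' r) \<le> \<bar>C\<bar>" for r by (simp add: w'_def)
    show "AE r in lebesgue_on {0..}. w' r = w r"
      using C by eventually_elim (auto simp: w'_def)
  qed
qed

lemma time_derivative_cong_AE:
  assumes w: "w \<in> borel_measurable (lebesgue_on {0..})" "w' \<in> borel_measurable (lebesgue_on {0..})"
    and eq: "AE r in lebesgue_on {0..}. w' r = w r" and fw: "time_derivative f w"
  shows "time_derivative f w'"
proof -
  have "(LINT t:{0..}|lebesgue. \<phi> t *\<^sub>R w' t) = (LINT t:{0..}|lebesgue. \<phi> t *\<^sub>R w t)"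
    if \<phi>: "\<phi> \<in> test_funs {0<..}" for \<phi> :: "real \<Rightarrow> real"
  proof -
    have "Ck 0 \<phi>" using \<phi> by (auto simp: test_funs_def simp del: Ck.simps)
    then have "continuous_on {0..} \<phi>" by (auto intro: continuous_on_subset)
    then have [measurable]: "\<phi> \<in> borel_measurable (lebesgue_on {0..})"
      by (rule continuous_imp_measurable_on_sets_lebesgue) simp
    note [measurable] = w
    have "(LINT t|lebesgue_on {0..}. \<phi> t *\<^sub>R w' t) = (LINT t|lebesgue_on {0..}. \<phi> t *\<^sub>R w t)"
      by (rule integral_cong_AE) (use eq in \<open>auto elim: eventually_mono\<close>)
    then show ?thesis by (simp add: set_lebesgue_integral_def integral_restrict_space)
  qed
  then show ?thesis using fw by (simp add: time_derivative_def)
qed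

text \<open>
  Damping removes energy at the rate
  \<open>\<eta> * (norm (v r))\<^sup>2\<close>, so if the system is at rest at time \<open>T\<close>, then the energy at an earlier time \<open>s\<close> is
  at most \<open>\<eta>\<close> times the integral of \<open>(norm (v r))\<^sup>2\<close> over \<open>[s, T]\<close>. Since the squared velocity is itself at
  most twice the energy, the backward Gronwall lemma forces everything to vanish. The subgradient at
  the initial point identifies \<open>F (u 0)\<close> with the value of the Lipschitz regularisation of \<open>F\<close> there.
\<close>

theorem damped_subgradient_flow_backward_rest:
  fixes u v w :: "real \<Rightarrow> 'b::{real_inner, banach, second_countable_topology}" and F :: "'b \<Rightarrow> ereal"
  assumes \<eta>: "0 \<le> \<eta>" and F_nonneg: "\<And>x. 0 \<le> F x" and H0: "0 \<in> H"
    and cont: "continuous_on {0..} u" "continuous_on {0..} v" and W: "W2_inf X u v w"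
    and flow: "AE r in lebesgue_on {0..}. \<exists>p\<in>subdifferential H F (u r). w r + \<eta> *\<^sub>R v r + p = 0"
    and init: "subdifferential H F (u 0) \<noteq> {}"
    and T: "0 \<le> T" and rest: "\<And>r. T \<le> r \<Longrightarrow> v r = 0 \<and> F (u r) = 0"
  shows "v 0 = 0 \<and> F (u 0) = 0"
proof -
  have Linf: "u \<in> Linf X" "v \<in> Linf X" "w \<in> Linf X"
    and td: "time_derivative u v" "time_derivative v w"
    using W by (auto simp: W2_inf_def)
  obtain w' C where w'[measurable]: "w' \<in> borel_measurable (lebesgue_on {0..})"
    and C: "\<And>r. norm (w' r) \<le> C" and w'w: "AE r in lebesgue_on {0..}. w' r = w r"
    using Linf_bounded_representative[OF Linf(3)] by blast
  have meas[measurable]: "v \<in> borel_measurable (lebesgue_on {0..})" "w \<in> borel_measurable (lebesgue_on {0..})"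
    using Linf by (auto simp: Linf_def)
  have "w' \<in> Linf UNIV" using C by (auto simp: Linf_def intro: AE_I2)
  then have vw: "weak_primitive v w'"
    by (rule time_derivative_imp_weak_primitive[OF cont(2) Linf(2) _ C
          time_derivative_cong_AE[OF meas(2) w' w'w td(2)]])
  have C0: "0 \<le> C" using order_trans[OF norm_ge_zero C] .
  define V where "V = norm (v 0) + C * T"
  have V0: "0 \<le> V" using C0 T by (simp add: V_def)
  \<comment> \<open>Up to time \<open>T\<close> the velocity is Lipschitz, and from then on it is zero.\<close>
  have V: "norm (v r) \<le> V" if "0 \<le> r" for r
  proof (cases "r \<le> T")
    case True
    have "norm (v r - v 0) \<le> C * (r - 0)"
      by (rule weak_primitive_Lipschitz[OF vw]) (use C that in auto)
    also have "\<dots> \<le> C * T" using True C0 by (simp add: mult_left_mono)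
    finally show ?thesis using norm_triangle_ineq2[of "v r" "v 0"] by (simp add: V_def)
  qed (use rest[of r] V0 in simp)
  have uv: "weak_primitive u v"
    by (rule time_derivative_imp_weak_primitive[OF cont(1) Linf(1,2) V td(1)])
  define z where "z = u T"
  have uz: "u r = z" if "T \<le> r" for r
    using weak_primitive_Lipschitz[OF uv T that, of 0] rest by (simp add: z_def)
  \<comment> \<open>The rest point is attained on \<open>[T, T + 1]\<close>, which contains a time at which the inclusion holds.\<close>
  have zH: "z \<in> H"
  proof -
    obtain N where N: "negligible N"
      "\<And>r. 0 \<le> r \<Longrightarrow> r \<notin> N \<Longrightarrow> \<exists>p\<in>subdifferential H F (u r). w r + \<eta> *\<^sub>R v r + p = 0"
      by (rule AE_nonneg_reals_negligible[OF flow]) auto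
    have "\<not> negligible {T..T+1}" using negligible_interval(1)[of T "T + 1"] by simp
    then have "\<not> {T..T+1} \<subseteq> N" using N(1) negligible_subset by blast
    then obtain r where "r \<in> {T..T+1}" "r \<notin> N" by blast
    then have "u r \<in> H" using N(2)[of r] T by (auto simp: subdifferential_def)
    then show ?thesis using uz[of r] \<open>r \<in> {T..T+1}\<close> by simp
  qed
  have Fz: "F z = 0" using rest[of T] by (simp add: z_def)
  obtain p0 where p0: "p0 \<in> subdifferential H F (u 0)" using init by blast
  define M where "M = max (C + \<eta> * V) (norm p0)"
  have M: "0 \<le> M" "norm p0 \<le> M" "C + \<eta> * V \<le> M"
    using order_trans[OF norm_ge_zero[of p0], of M] by (auto simp: M_def)
  define \<Phi> where "\<Phi> = affine_minorant_hull H F M"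
  note hull = F_nonneg zH Fz H0 M(1)
  define p where "p r = - (w' r + \<eta> *\<^sub>R v r)" for r
  have [measurable]: "p \<in> borel_measurable (lebesgue_on {0..})" unfolding p_def by measurable
  have pM: "norm (p r) \<le> M" if "0 \<le> r" for r
  proof -
    have "norm (p r) \<le> norm (w' r) + norm (\<eta> *\<^sub>R v r)"
      unfolding p_def norm_minus_cancel by (rule norm_triangle_ineq)
    also have "\<dots> \<le> C + \<eta> * V" using C[of r] V[OF that] \<eta> by (simp add: add_mono mult_left_mono)
    finally show ?thesis using M(3) by simp
  qed
  have sub: "AE r in lebesgue_on {0..}. \<forall>y. \<Phi> (u r) + p r \<bullet> (y - u r) \<le> \<Phi> y"
  proof -
    have "AE r in lebesgue_on {0..}. 0 \<le> r"
      by (auto intro: AE_I2 simp: space_restrict_space)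
    with flow w'w show ?thesis
    proof eventually_elim
      case (elim r)
      then obtain q where q: "q \<in> subdifferential H F (u r)" "w r + \<eta> *\<^sub>R v r + q = 0" by blast
      then have "q = - (w r + \<eta> *\<^sub>R v r)" by (simp only: add_eq_0_iff)
      then have "q = p r" using elim(2) by (simp add: p_def)
      then show ?case
        using affine_minorant_hull_subgradient[where F=F, OF hull, of "p r" "u r"] q(1) pM[OF elim(3)]
        by (simp add: \<Phi>_def)
    qed
  qed
  define g where "g r = (norm (v r))\<^sup>2" for r
  have gcont: "continuous_on {a..b} g" if "0 \<le> a" for a b
    unfolding g_def by (intro continuous_intros continuous_on_subset[OF cont(2)]) (use that in auto)
  \<comment> \<open>The energy balance on \<open>[s, T]\<close>: \<open>p = - w - \<eta> v\<close> converts the potential energy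
      into kinetic energy and dissipation.\<close>
  have energy: "g s / 2 + \<Phi> (u s) \<le> \<eta> * integral {s..T} g" if s: "0 \<le> s" "s \<le> T" for s
  proof -
    have "((\<lambda>r. w' r \<bullet> v r) has_integral (g T - g s) / 2) {s..T}"
      unfolding g_def by (rule kinetic_energy_identity[OF vw meas(1) w' C V s])
    moreover have "(g has_integral integral {s..T} g) {s..T}"
      by (intro integrable_integral integrable_continuous_real gcont s)
    ultimately have "((\<lambda>r. - (w' r \<bullet> v r) - \<eta> * g r) has_integral
        - ((g T - g s) / 2) - \<eta> * integral {s..T} g) {s..T}"
      by (intro has_integral_diff has_integral_neg has_integral_mult_right)
    moreover have "p r \<bullet> v r = - (w' r \<bullet> v r) - \<eta> * g r" for r
      by (simp add: p_def g_def inner_diff_left inner_add_left power2_norm_eq_inner)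
    ultimately have "integral {s..T} (\<lambda>r. p r \<bullet> v r) = - ((g T - g s) / 2) - \<eta> * integral {s..T} g"
      by (simp add: integral_unique)
    moreover have "integral {s..T} (\<lambda>r. p r \<bullet> v r) \<le> \<Phi> (u T) - \<Phi> (u s)"
      by (rule subgradient_chain_rule_ineq[OF _ uv vw meas(1) _ C V pM sub s])
        (use affine_minorant_hull_Lipschitz[where F=F, OF hull] in \<open>auto simp: \<Phi>_def\<close>)
    moreover have "\<Phi> (u T) = 0" using affine_minorant_hull_zero[where F=F, OF hull] by (simp add: \<Phi>_def z_def)
    moreover have "g T = 0" using rest[of T] by (simp add: g_def)
    ultimately show ?thesis by (simp add: field_simps)
  qed
  have \<Phi>0: "0 \<le> \<Phi> y" for y using affine_minorant_hull_nonneg[where F=F, OF hull] by (simp add: \<Phi>_def)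
  have "integral {0..T} g \<le> 0"
  proof (rule backward_Gronwall[OF T gcont])
    show "g s \<le> (2 * \<eta>) * integral {s..T} g" if "0 \<le> s" "s \<le> T" for s
      using energy[OF that] \<Phi>0[of "u s"] by simp
  qed simp
  then have "\<eta> * integral {0..T} g \<le> 0"
    by (rule mult_nonneg_nonpos[OF \<eta>])
  then have "g 0 / 2 + \<Phi> (u 0) \<le> 0"
    by (rule order_trans[OF energy[OF order_refl T]])
  moreover have "0 \<le> g 0" by (simp add: g_def)
  ultimately have "g 0 = 0" "\<Phi> (u 0) = 0" using \<Phi>0[of "u 0"] by linarith+
  moreover have "F (u 0) = ereal (\<Phi> (u 0))"
    unfolding \<Phi>_def by (rule affine_minorant_hull_eq[where F=F, OF hull p0 M(2), symmetric])
  ultimately have "(norm (v 0))\<^sup>2 = 0" "F (u 0) = 0"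
    unfolding g_def by (simp_all only: zero_ereal_def)
  then show ?thesis by simp
qed

section \<open>The total variation flow\<close>

lemma Ck_zero: "Ck k (\<lambda>x. 0)"
  by (induction k) (simp_all add: frechet_derivative_const)

lemma TV_nonneg: "0 \<le> TV \<Omega> u"
proof -
  have "(\<lambda>x. 0) \<in> {v \<in> test_funs \<Omega>. \<forall>x\<in>\<Omega>. norm (v x) \<le> 1}"
    by (auto simp: test_funs_def Ck_zero intro: exI[of _ "{}"])
  then have "ereal (LINT x:\<Omega>|lebesgue. f x * divergence (\<lambda>x. 0) x) \<le> variation \<Omega> f" for f
    unfolding variation_def by (rule SUP_upper)
  then have "0 \<le> variation \<Omega> f" for f
    by (simp add: divergence_def frechet_derivative_const set_lebesgue_integral_def zero_ereal_def)
  then show ?thesis by (simp add: TV_def)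
qed

lemma zero_in_L2: "0 \<in> L2 \<Omega>"
  using rep_abs_l2[OF square_integrable_zero] by (auto simp: L2_def zero_l2_def elim: eventually_mono)

theorem theorem2p8:
  fixes \<Omega> :: "(real ^ 'n) set" and \<eta> :: real
    and u\<^sub>0 v\<^sub>0 :: "(real ^ 'n) l2" and u u' :: "real \<Rightarrow> (real ^ 'n) l2"
  assumes "open \<Omega>" and "connected \<Omega>" and "\<Omega> \<noteq> {}" and "bounded \<Omega>" and "lipschitz_boundary \<Omega>"
    and "\<eta> > 0"
    and "u\<^sub>0 \<in> dom_subdiff_TV \<Omega>" and "v\<^sub>0 \<in> dom_subdiff_TV \<Omega> \<inter> L2 \<Omega>"
    and "weak_solution \<Omega> \<eta> u\<^sub>0 v\<^sub>0 u u'"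
    and "energy \<Omega> u u' 0 > 0"
  shows "\<not> (\<exists>T>0. \<forall>t\<ge>T. energy \<Omega> u u' t = 0)"
proof
  assume "\<exists>T>0. \<forall>t\<ge>T. energy \<Omega> u u' t = 0"
  then obtain T where T: "0 < T" "\<And>t. T \<le> t \<Longrightarrow> energy \<Omega> u u' t = 0" by blast
  have rest: "u' t = 0 \<and> TV \<Omega> (u t) = 0" if "T \<le> t" for t
  proof -
    have "ereal (1/2 * (norm (u' t))\<^sup>2) + TV \<Omega> (u t) = 0"
      using T(2)[OF that] by (simp only: energy_def)
    then have "TV \<Omega> (u t) = 0 \<and> (norm (u' t))\<^sup>2 = 0"
      using TV_nonneg[of \<Omega> "u t"] zero_le_power2[of "norm (u' t)"]
      by (cases "TV \<Omega> (u t)") (simp_all add: zero_ereal_def add_nonneg_eq_0_iff)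
    then show ?thesis by simp
  qed
  obtain u'' where W: "W2_inf (L2 \<Omega>) u u' u''"
    and flow: "AE t in lebesgue_on {0..}. \<exists>p\<in>subdifferential (L2 \<Omega>) (TV \<Omega>) (u t). u'' t + \<eta> *\<^sub>R u' t + p = 0"
    and cont: "continuous_on {0..} u" "continuous_on {0..} u'" and "u 0 = u\<^sub>0"
    using assms(9) by (auto simp: weak_solution_def subdiff_TV_def)
  have init: "subdifferential (L2 \<Omega>) (TV \<Omega>) (u 0) \<noteq> {}"
    using assms(7) \<open>u 0 = u\<^sub>0\<close> by (simp add: dom_subdiff_TV_def subdiff_TV_def)
  have "0 \<le> \<eta>" "0 \<le> T" using \<open>\<eta> > 0\<close> T(1) by simp_all
  then have "u' 0 = 0 \<and> TV \<Omega> (u 0) = 0"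
    by (rule damped_subgradient_flow_backward_rest[OF _ TV_nonneg zero_in_L2 cont W flow init _ rest])
  then show False using assms(10) by (simp add: energy_def)
qed

end
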